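(* Let $a<b$ be real numbers and let $X_n \in \mathcal{S}^n$, $n = 1,2,\dots$, be a sequence of random matrices all of whose eigenvalues lie in $[a,b]$, such that the empirical spectral distribution $L_{X_n}$ converges in probability to $\sigma(x)\,dx$ on $[a,b]$, where $\sigma \in C([a,b])$ and $a,b \in \mathrm{supp}(\sigma)$. Then, for all $m \in \mathbb{N}$ (with $m\ge1$) and $\epsilon >0$, $$\lim_{n \rightarrow \infty} \mathbb{P} \left( \left| \frac{\lambda_1(X_n) - \lambda^{(m)}_1(X_n,v)}{\lambda_1(X_n) - \lambda_n(X_n)} - \frac{b-\xi(m)}{b-a} \right| > \epsilon \right) = 0,$$ where $v\sim\mathcal{U}(S^{n-1})$ is a random initial vector independent of $X_n$, and $\xi(m)$ is the largest zero of the degree-$m$ orthogonal polynomial with respect to the weight $\sigma(x)$ on the interval $[a,b]$.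
   Context: $\mathcal{S}^n$ is the set of real symmetric $n\times n$ matrices; the eigenvalues of $X\in\mathcal{S}^n$, with multiplicity, are $\lambda_1(X)\ge\dots\ge\lambda_n(X)$. The empirical spectral distribution is $L_{X_n}=\frac1n\sum_{i=1}^n\delta_{\lambda_i(X_n)}$. Convergence in probability of $L_{X_n}$ to $\sigma(x)\,dx$ means: for every continuous $f:[a,b]\to\mathbb{R}$ and every $\epsilon>0$, $\mathbb{P}\left(\left|\int f\,dL_{X_n}-\int_a^b f(x)\sigma(x)\,dx\right|>\epsilon\right)\to0$ as $n\to\infty$; in particular $\sigma$ is a probability density on $[a,b]$. $\mathcal{U}(S^{n-1})$ is the uniform probability measure on $S^{n-1}=\{x\in\mathbb{R}^n : \|x\|=1\}$. For a positive integer $m$ and nonzero $v\in\mathbb{R}^n$, the Krylov subspace is $\mathcal{K}_m(X,v)=\mathrm{span}\{v,Xv,\dots,X^{m-1}v\}$, and the largest Ritz value is $$\lambda_1^{(m)}(X,v)=\max_{x\in\mathcal{K}_m(X,v),\,x\neq 0}\frac{x^TXx}{x^Tx}.$$ The quotient with denominator $\lambda_1(X_n)-\lambda_n(X_n)$ is taken to be $0$ when $\lambda_1(X_n)=\lambda_n(X_n)$. The degree-$m$ orthogonal polynomial of $\sigma$ is the (unique up to scaling) polynomial of degree $m$ orthogonal in $\int_a^b(\cdot)(\cdot)\sigma(x)\,dx$ to all polynomials of degree less than $m$. *)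

theory Defs
  imports
    "HOL-Probability.Probability"
    "Jordan_Normal_Form.Char_Poly"
    "Jordan_Normal_Form.VS_Connect"
begin

unbundle no vec_syntax
unbundle no fps_syntax
unbundle no inner_syntax
hide_const (open) Finite_Cartesian_Product.vec Finite_Cartesian_Product.mat

definition symmetric_mats :: "nat \<Rightarrow> real mat set" where
  "symmetric_mats n = {A \<in> carrier_mat n n. transpose_mat A = A}"

text \<open>
  \<open>eig A i\<close> is the \<open>i\<close>-th largest eigenvalue of \<open>A\<close>, for \<open>1 \<le> i \<le> n\<close>: the roots of the
  characteristic polynomial are listed with multiplicity in weakly decreasing order. A symmetric
  \<open>n \<times> n\<close> matrix has exactly \<open>n\<close> of them.
\<close>

definition eig :: "real mat \<Rightarrow> nat \<Rightarrow> real" where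
  "eig A i = rev (sorted_list_of_multiset (proots (char_poly A))) ! (i - 1)"

text \<open>The empirical spectral distribution, for a matrix of dimension at least one.\<close>

definition esd :: "real mat \<Rightarrow> real pmf" where
  "esd A = map_pmf (eig A) (pmf_of_set {1..dim_row A})"

definition esd_tendsto_in_prob ::
  "(nat \<Rightarrow> 'a measure) \<Rightarrow> (nat \<Rightarrow> 'a \<Rightarrow> real mat) \<Rightarrow> real \<Rightarrow> real \<Rightarrow> (real \<Rightarrow> real) \<Rightarrow> bool" where
  "esd_tendsto_in_prob M X a b \<sigma> \<longleftrightarrow>
     (\<forall>f \<epsilon>. continuous_on {a..b} f \<longrightarrow> \<epsilon> > 0 \<longrightarrow>
       (\<lambda>n. measure (M n) {\<omega> \<in> space (M n).
          \<bar>measure_pmf.expectation (esd (X n \<omega>)) f - integral {a..b} (\<lambda>x. f x * \<sigma> x)\<bar> > \<epsilon>})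
       \<longlonglongrightarrow> 0)"

text \<open>The support, relative to \<open>{a..b}\<close>, of a function given on \<open>{a..b}\<close>.\<close>

definition support_within :: "real \<Rightarrow> real \<Rightarrow> (real \<Rightarrow> real) \<Rightarrow> real set" where
  "support_within a b \<sigma> = closure {x \<in> {a..b}. \<sigma> x \<noteq> 0}"

text \<open>
  The types \<open>real vec\<close> and \<open>real mat\<close> contain vectors and matrices of all dimensions. The following
  are the Borel \<open>\<sigma>\<close>-algebras of the spaces of fixed dimension, generated by the entries.
\<close>

definition vec_borel :: "nat \<Rightarrow> real vec measure" where
  "vec_borel n = vimage_algebra (carrier_vec n) (\<lambda>x. \<lambda>i\<in>{..<n}. x $ i) (\<Pi>\<^sub>M i\<in>{..<n}. borel)"

definition mat_borel :: "nat \<Rightarrow> real mat measure" where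
  "mat_borel n = vimage_algebra (carrier_mat n n) (\<lambda>A. \<lambda>ij\<in>{..<n} \<times> {..<n}. A $$ ij)
     (\<Pi>\<^sub>M ij\<in>{..<n} \<times> {..<n}. borel)"

definition vec_lborel :: "nat \<Rightarrow> real vec measure" where
  "vec_lborel n = distr (\<Pi>\<^sub>M i\<in>{..<n}. lborel) (vec_borel n) (\<lambda>x. vec n x)"

definition vnorm :: "real vec \<Rightarrow> real" where
  "vnorm x = sqrt (x \<bullet> x)"

text \<open>
  The library's \<open>indep_var\<close> requires both variables to take values in the same type. For variables
  of one type, this is equivalent to it by \<open>indep_var_eq\<close>; the \<open>\<sigma>\<close>-closures there add nothing,
  since the preimages already form \<open>\<sigma>\<close>-algebras.
\<close>

definition indep_rvs ::
  "'a measure \<Rightarrow> 'b measure \<Rightarrow> ('a \<Rightarrow> 'b) \<Rightarrow> 'c measure \<Rightarrow> ('a \<Rightarrow> 'c) \<Rightarrow> bool" where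
  "indep_rvs M S Y T Z \<longleftrightarrow> Y \<in> measurable M S \<and> Z \<in> measurable M T \<and>
     prob_space.indep_set M {Y -` A \<inter> space M |A. A \<in> sets S} {Z -` B \<inter> space M |B. B \<in> sets T}"

text \<open>
  The normalised surface measure of the unit sphere, as the cone measure: the mass of a set \<open>A\<close> of
  unit vectors is the fraction of the volume of the unit ball that is taken up by the segments from
  \<open>0\<close> to the points of \<open>A\<close>. The origin, which the radial projection does not send to the sphere,
  is a null set for \<open>n \<ge> 1\<close>.
\<close>

definition uniform_sphere :: "nat \<Rightarrow> real vec measure" where
  "uniform_sphere n =
     distr (uniform_measure (vec_lborel n) {x \<in> carrier_vec n. vnorm x \<le> 1}) (vec_borel n)
       (\<lambda>x. (1 / vnorm x) \<cdot>\<^sub>v x)"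

definition krylov :: "nat \<Rightarrow> real mat \<Rightarrow> real vec \<Rightarrow> real vec set" where
  "krylov m A v = LinearCombinations.module.span class_ring (module_vec TYPE(real) (dim_vec v))
     ((\<lambda>k. (A ^\<^sub>m k) *\<^sub>v v) ` {..<m})"

text \<open>The supremum is attained if \<open>v \<noteq> 0\<close> and \<open>m \<ge> 1\<close>.\<close>

definition ritz_max :: "nat \<Rightarrow> real mat \<Rightarrow> real vec \<Rightarrow> real" where
  "ritz_max m A v =
     (SUP x \<in> {x \<in> krylov m A v. x \<noteq> 0\<^sub>v (dim_vec v)}. (x \<bullet> (A *\<^sub>v x)) / (x \<bullet> x))"

text \<open>The orthogonal polynomial of degree \<open>m\<close>, made unique by taking it monic.\<close>

definition orth_poly :: "real \<Rightarrow> real \<Rightarrow> (real \<Rightarrow> real) \<Rightarrow> nat \<Rightarrow> real poly" where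
  "orth_poly a b \<sigma> m = (THE p. degree p = m \<and> lead_coeff p = 1 \<and>
     (\<forall>q. degree q < m \<longrightarrow> integral {a..b} (\<lambda>x. poly p x * poly q x * \<sigma> x) = 0))"

definition largest_zero :: "real poly \<Rightarrow> real" where
  "largest_zero p = Max {x. poly p x = 0}"

end

theory Submission
  imports Defs "Jordan_Normal_Form.Schur_Decomposition"
begin

text \<open>
  The largest Ritz value sees \<open>X\<^sub>n\<close> and \<open>v\<close> only through the numbers \<open>\<nu>\<^sub>k = v\<^sup>T X\<^sub>n\<^sup>k v\<close> with
  \<open>k < 2m\<close>: writing \<open>x = \<Sum>i<m. c\<^sub>i X\<^sub>n\<^sup>i v\<close> gives \<open>x\<^sup>T x = \<Sum>\<^sub>i\<^sub>j c\<^sub>i c\<^sub>j \<nu>\<^sub>i\<^sub>+\<^sub>j\<close> and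
  \<open>x\<^sup>T X\<^sub>n x = \<Sum>\<^sub>i\<^sub>j c\<^sub>i c\<^sub>j \<nu>\<^sub>i\<^sub>+\<^sub>j\<^sub>+\<^sub>1\<close>, so the Ritz value is the supremum of a quotient of two Hankel
  forms (\<open>ritz_max_hankel\<close>). If the \<open>\<nu>\<^sub>k\<close> are replaced by the moments \<open>\<mu>\<^sub>k\<close> of \<open>\<sigma>\<close>, the quotient
  becomes \<open>(\<integral> x q(x)\<^sup>2 \<sigma>) / (\<integral> q(x)\<^sup>2 \<sigma>)\<close> for a polynomial \<open>q\<close> of degree below \<open>m\<close>, and its
  maximum \<open>\<theta>\<close> is exactly the largest zero of the orthogonal polynomial: at a maximiser \<open>q\<close> the first
  variation says that \<open>(x - \<theta>) q\<close> is orthogonal to all polynomials of degree below \<open>m\<close>, hence is a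
  multiple of the orthogonal polynomial, and conversely a zero \<open>\<xi>\<close> of \<open>p = (x - \<xi>) r\<close> is the value of
  the quotient at \<open>r\<close> (\<open>largest_zero_orth_poly\<close>). Since the limiting denominator is positive definite,
  the maximum depends continuously on finitely many moments (\<open>hankel_ratio_stable\<close>).

  It remains to see that \<open>\<nu>\<^sub>k\<close> tends to \<open>\<mu>\<^sub>k\<close> in probability. The normalised trace \<open>tr X\<^sub>n\<^sup>k / n\<close> is
  the \<open>k\<close>-th moment of the empirical spectral distribution (\<open>eig_sum_pow\<close>, read off a
  Schur triangularisation), and it tends to \<open>\<mu>\<^sub>k\<close> by hypothesis.
  The difference of \<open>v\<^sup>T X\<^sub>n\<^sup>k v\<close> and \<open>tr X\<^sub>n\<^sup>k / n\<close> is the quadratic form of \<open>v\<close> in the trace-free part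
  \<open>D\<close> of \<open>X\<^sub>n\<^sup>k\<close>. By independence its second moment only involves the fourth moments of the uniform
  distribution on the sphere, and equals \<open>2 \<cdot> E(\<Sum>\<^sub>i\<^sub>j D\<^sub>i\<^sub>j\<^sup>2) / (n (n + 2)) = O(1/n)\<close>
  (\<open>quadratic_form_second_moment\<close>); Markov's inequality finishes this step
  (\<open>krylov_moment_concentration\<close>). The fourth moments (\<open>sphere_fourth_moment\<close>) are obtained from two
  symmetries only: changing the sign of a coordinate, and mixing two coordinates by a reflection.

  Finally \<open>\<lambda>\<^sub>1(X\<^sub>n)\<close> and \<open>\<lambda>\<^sub>n(X\<^sub>n)\<close> tend to \<open>b\<close> and \<open>a\<close>: as these points lie in the support of \<open>\<sigma>\<close>,
  finitely many trace moments close to those of \<open>\<sigma>\<close> force an eigenvalue near each of them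
  (\<open>moments_detect_mass\<close>). That \<open>\<sigma>\<close> is nonnegative with total mass one is itself a consequence of
  the convergence hypothesis. Working with powers of \<open>X\<^sub>n\<close> throughout means that every event whose
  probability is estimated is visibly measurable; the event of the theorem is contained in a finite
  union of such events.
\<close>

section \<open>Symmetric matrices and the power sums of their eigenvalues\<close>

lemma symmetric_mats_carrier: "A \<in> symmetric_mats n \<Longrightarrow> A \<in> carrier_mat n n"
  by (simp add: symmetric_mats_def)

lemma symmetric_mats_entry:
  assumes "A \<in> symmetric_mats n" "i < n" "j < n"
  shows "A $$ (j, i) = A $$ (i, j)"
proof -
  have "transpose_mat A $$ (i, j) = A $$ (j, i)"
    using assms by (intro index_transpose_mat) (auto simp: symmetric_mats_def)
  then show ?thesis using assms by (simp add: symmetric_mats_def)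
qed

lemma index_mult_mat_sum:
  assumes "A \<in> carrier_mat n n" "B \<in> carrier_mat n n" "i < n" "j < n"
  shows "(A * B) $$ (i, j) = (\<Sum>k<n. A $$ (i, k) * B $$ (k, j))"
  using assms by (auto simp: scalar_prod_def atLeast0LessThan)

lemma index_mult_mat_vec_sum:
  assumes "A \<in> carrier_mat n n" "x \<in> carrier_vec n" "i < n"
  shows "(A *\<^sub>v x) $ i = (\<Sum>k<n. A $$ (i, k) * x $ k)"
  using assms by (auto simp: scalar_prod_def atLeast0LessThan)

text \<open>
  For an eigenvector \<open>x\<close> the number \<open>x\<^sup>* A x = \<mu> \<cdot> \<parallel>x\<parallel>\<^sup>2\<close> equals its own conjugate, because \<open>A\<close> is real
  and symmetric.
\<close>

lemma eigenvalue_symmetric_real: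
  assumes A: "A \<in> symmetric_mats n"
    and ev: "eigenvalue (map_mat complex_of_real A) \<mu>"
  shows "\<mu> \<in> \<real>"
proof -
  let ?C = "map_mat complex_of_real A"
  have dA: "A \<in> carrier_mat n n" using A by (rule symmetric_mats_carrier)
  obtain x where x: "x \<in> carrier_vec n" "x \<noteq> 0\<^sub>v n" "?C *\<^sub>v x = \<mu> \<cdot>\<^sub>v x"
    using ev dA unfolding eigenvalue_def eigenvector_def by auto
  define s where "s = (\<Sum>i<n. \<Sum>j<n. cnj (x $ i) * of_real (A $$ (i, j)) * x $ j)"
  define r where "r = (\<Sum>i<n. (cmod (x $ i))\<^sup>2)"
  have row: "(\<Sum>j<n. of_real (A $$ (i, j)) * x $ j) = \<mu> * x $ i" if "i < n" for i
  proof -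
    have "(\<Sum>j<n. of_real (A $$ (i, j)) * x $ j) = (?C *\<^sub>v x) $ i"
      using dA x that by (subst index_mult_mat_vec_sum[of _ n]) auto
    then show ?thesis using x that by simp
  qed
  have "s = (\<Sum>i<n. cnj (x $ i) * (\<mu> * x $ i))"
    unfolding s_def
    by (intro sum.cong refl) (auto simp: row[symmetric] sum_distrib_left mult.assoc)
  also have "\<dots> = \<mu> * of_real r"
    unfolding r_def of_real_sum sum_distrib_left
    by (intro sum.cong refl) (simp only: complex_norm_square mult_ac)
  finally have s: "s = \<mu> * of_real r" .
  have "cnj s = (\<Sum>i<n. \<Sum>j<n. cnj (x $ j) * of_real (A $$ (i, j)) * x $ i)"
    unfolding s_def by (simp add: mult_ac)
  also have "\<dots> = (\<Sum>j<n. \<Sum>i<n. cnj (x $ j) * of_real (A $$ (i, j)) * x $ i)"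
    by (rule sum.swap)
  also have "\<dots> = s"
    unfolding s_def by (intro sum.cong refl) (simp add: symmetric_mats_entry[OF A])
  finally have "cnj s = s" .
  then have "s \<in> \<real>" by (simp add: Reals_cnj_iff)
  moreover have "r \<noteq> 0"
  proof
    assume "r = 0"
    then have "\<forall>i\<in>{..<n}. (cmod (x $ i))\<^sup>2 = 0"
      unfolding r_def by (subst (asm) sum_nonneg_eq_0_iff) auto
    then have "x = 0\<^sub>v n" using x by auto
    with x show False by simp
  qed
  ultimately have "s / of_real r \<in> \<real>" by (intro Reals_divide) auto
  with s \<open>r \<noteq> 0\<close> show ?thesis by simp
qed

text \<open>
  The characteristic polynomial splits over the complex numbers, and its roots are real; injectivity
  of the coefficient embedding brings the factorisation back to real polynomials.
\<close>

lemma symmetric_char_poly_splits: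
  assumes A: "A \<in> symmetric_mats n"
  shows "\<exists>es :: real list. char_poly A = (\<Prod>a\<leftarrow>es. [:- a, 1:])"
proof -
  let ?C = "map_mat complex_of_real A"
  have dA: "A \<in> carrier_mat n n" using A by (rule symmetric_mats_carrier)
  then have dC: "?C \<in> carrier_mat n n" by simp
  obtain as where as: "char_poly ?C = (\<Prod>a\<leftarrow>as. [:- a, 1:])"
    using char_poly_factorized[OF dC] by auto
  have real: "a \<in> \<real>" if "a \<in> set as" for a
  proof (rule eigenvalue_symmetric_real[OF A])
    have "poly (char_poly ?C) a = 0"
      unfolding as using that by (rule linear_poly_root)
    then show "eigenvalue ?C a" using eigenvalue_root_char_poly[OF dC] by simp
  qed
  interpret c: map_poly_inj_idom_hom complex_of_real ..
  define es where "es = map Re as"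
  have as_eq: "as = map of_real es"
    unfolding es_def by (rule sym, simp add: comp_def, rule map_idI)
      (use real in \<open>auto simp: of_real_Re\<close>)
  have "map_poly complex_of_real (char_poly A) = char_poly ?C"
    by (rule of_real_hom.char_poly_hom[OF dA, symmetric])
  also have "\<dots> = map_poly complex_of_real (\<Prod>a\<leftarrow>es. [:- a, 1:])"
    unfolding as as_eq by (simp add: c.hom_prod_list comp_def)
  finally have "char_poly A = (\<Prod>a\<leftarrow>es. [:- a, 1:])"
    by (simp add: c.eq_iff)
  then show ?thesis by blast
qed

definition mtrace :: "'a :: comm_ring_1 mat \<Rightarrow> 'a" where
  "mtrace A = (\<Sum>i<dim_row A. A $$ (i, i))"

lemma mtrace_mult_commute:
  fixes A B :: "'a :: comm_ring_1 mat"
  assumes "A \<in> carrier_mat n n" "B \<in> carrier_mat n n"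
  shows "mtrace (A * B) = mtrace (B * A)"
proof -
  have "mtrace (A * B) = (\<Sum>i<n. \<Sum>k<n. A $$ (i, k) * B $$ (k, i))"
    unfolding mtrace_def using assms
    by (intro sum.cong) (auto simp: index_mult_mat_sum simp del: index_mult_mat(1))
  also have "\<dots> = (\<Sum>k<n. \<Sum>i<n. B $$ (k, i) * A $$ (i, k))"
    by (subst sum.swap) (simp add: mult.commute)
  also have "\<dots> = mtrace (B * A)"
    unfolding mtrace_def using assms
    by (intro sum.cong) (auto simp: index_mult_mat_sum simp del: index_mult_mat(1))
  finally show ?thesis .
qed

text \<open>
  Trace invariance reduces power sums of eigenvalues to a triangular matrix, where they can be read
  off the diagonal.
\<close>

lemma mtrace_similar_pow:
  fixes A B :: "'a :: comm_ring_1 mat"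
  assumes "similar_mat A B"
  shows "mtrace (A ^\<^sub>m k) = mtrace (B ^\<^sub>m k)"
proof -
  obtain P Q where "similar_mat_wit A B P Q" using assms by (auto simp: similar_mat_def)
  then have w: "similar_mat_wit (A ^\<^sub>m k) (B ^\<^sub>m k) P Q" by (rule similar_mat_wit_pow)
  define n where "n = dim_row (A ^\<^sub>m k)"
  note D = similar_mat_witD[OF n_def w]
  have "mtrace (A ^\<^sub>m k) = mtrace (P * (B ^\<^sub>m k * Q))"
    using assoc_mult_mat[OF D(6,5,7)] D(3) by simp
  also have "\<dots> = mtrace (B ^\<^sub>m k * Q * P)"
    using D by (intro mtrace_mult_commute[of _ n]) auto
  also have "B ^\<^sub>m k * Q * P = B ^\<^sub>m k"
    using assoc_mult_mat[OF D(5,7,6)] right_mult_one_mat[OF D(5)] by (simp add: D(2))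
  finally show ?thesis .
qed

lemma upper_triangular_pow:
  fixes B :: "'a :: comm_ring_1 mat"
  assumes B: "B \<in> carrier_mat n n" "upper_triangular B"
  shows "upper_triangular (B ^\<^sub>m k) \<and> (\<forall>i<n. (B ^\<^sub>m k) $$ (i, i) = (B $$ (i, i)) ^ k)"
proof (induction k)
  case 0
  show ?case using B by (auto simp: upper_triangular_def)
next
  case (Suc k)
  define C where "C = B ^\<^sub>m k"
  have C: "C \<in> carrier_mat n n" unfolding C_def using B by simp
  have Cu: "C $$ (i, j) = 0" if "j < i" "i < n" for i j
    using Suc that C by (auto simp: C_def[symmetric] dest: upper_triangularD)
  have Bu: "B $$ (i, j) = 0" if "j < i" "i < n" for i j
    using B that by (auto dest: upper_triangularD)
  have "(C * B) $$ (i, j) = 0" if "j < i" "i < n" for i j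
  proof -
    have "C $$ (i, l) * B $$ (l, j) = 0" if "l < n" for l
      using Cu[of l i] Bu[of j l] \<open>j < i\<close> \<open>i < n\<close> that by (cases "l < i") auto
    then show ?thesis using that B C by (simp add: index_mult_mat_sum del: index_mult_mat(1))
  qed
  moreover have "(C * B) $$ (i, i) = (B $$ (i, i)) ^ Suc k" if "i < n" for i
  proof -
    have "C $$ (i, l) * B $$ (l, i) = (if l = i then C $$ (i, i) * B $$ (i, i) else 0)"
      if "l < n" for l
      using Cu[of l i] Bu[of i l] \<open>i < n\<close> that by (cases l i rule: linorder_cases) auto
    then have "(\<Sum>l<n. C $$ (i, l) * B $$ (l, i))
        = (\<Sum>l<n. if l = i then C $$ (i, i) * B $$ (i, i) else 0)"
      by (intro sum.cong refl) simp
    also have "\<dots> = C $$ (i, i) * B $$ (i, i)" using that by simp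
    finally have "(C * B) $$ (i, i) = C $$ (i, i) * B $$ (i, i)"
      by (simp only: index_mult_mat_sum[OF C B(1) that that])
    then show ?thesis using Suc that by (simp add: C_def mult.commute)
  qed
  ultimately show ?case using B C by (auto simp: upper_triangular_def C_def[symmetric])
qed

lemma proots_prod_linear_factors:
  "proots (\<Prod>a\<leftarrow>es. [:- a, 1:]) = mset (es :: 'a :: idom list)"
proof (induction es)
  case (Cons a es)
  have "(\<Prod>a\<leftarrow>es. [:- a, 1:]) \<noteq> (0 :: 'a poly)" by (auto simp: prod_list_zero_iff)
  then have "proots ([:- a, 1:] * (\<Prod>a\<leftarrow>es. [:- a, 1:]))
    = proots [:- a, 1:] + proots (\<Prod>a\<leftarrow>es. [:- a, 1:])"
    by (intro proots_mult) auto
  then show ?case using Cons by (simp del: mult_pCons_left)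
qed simp

text \<open>
  An upper triangular matrix has its eigenvalues, with
  multiplicity, on the diagonal, and the diagonal of its \<open>k\<close>-th power consists of their powers.
\<close>

lemma symmetric_trace_pow:
  assumes A: "A \<in> symmetric_mats n"
  shows "size (proots (char_poly A)) = n"
    and "(\<Sum>x\<in>#proots (char_poly A). x ^ k) = mtrace (A ^\<^sub>m k)"
proof -
  have dA: "A \<in> carrier_mat n n" using A by (rule symmetric_mats_carrier)
  obtain es where es: "char_poly A = (\<Prod>a\<leftarrow>es. [:- a, 1:])"
    using symmetric_char_poly_splits[OF A] by blast
  obtain B where B: "B \<in> carrier_mat n n" "upper_triangular B" "similar_mat A B"
    using schur_decomposition_exists[OF dA es] by blast
  have "char_poly A = (\<Prod>a\<leftarrow>diag_mat B. [:- a, 1:])"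
    using char_poly_similar[OF B(3)] char_poly_upper_triangular[OF B(1,2)] by simp
  then have pr: "proots (char_poly A) = mset (diag_mat B)"
    by (simp add: proots_prod_linear_factors)
  show "size (proots (char_poly A)) = n" using B by (simp add: pr diag_mat_def)
  have "(\<Sum>x\<in>#proots (char_poly A). x ^ k) = sum_list (map (\<lambda>x. x ^ k) (diag_mat B))"
    unfolding pr by (metis mset_map sum_mset_sum_list)
  also have "\<dots> = (\<Sum>i<n. (B $$ (i, i)) ^ k)"
    using B by (simp add: diag_mat_def comp_def interv_sum_list_conv_sum_set_nat atLeast0LessThan)
  also have "\<dots> = mtrace (B ^\<^sub>m k)"
    using upper_triangular_pow[OF B(1,2), of k] B by (simp add: mtrace_def)
  also have "\<dots> = mtrace (A ^\<^sub>m k)" using mtrace_similar_pow[OF B(3)] by simp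
  finally show "(\<Sum>x\<in>#proots (char_poly A). x ^ k) = mtrace (A ^\<^sub>m k)" .
qed

lemma eig_sum_pow:
  assumes A: "A \<in> symmetric_mats n"
  shows "(\<Sum>i=1..n. eig A i ^ k) = mtrace (A ^\<^sub>m k)"
proof -
  define L where "L = rev (sorted_list_of_multiset (proots (char_poly A)))"
  have m: "mset L = proots (char_poly A)" by (simp add: L_def)
  have len: "length L = n" using symmetric_trace_pow(1)[OF A] m by (metis size_mset)
  have "(\<Sum>i=1..n. eig A i ^ k) = (\<Sum>i<n. (L ! i) ^ k)"
    unfolding eig_def L_def[symmetric]
    by (rule sum.reindex_bij_witness[of _ Suc "\<lambda>i. i - 1"]) auto
  also have "\<dots> = sum_list (map (\<lambda>x. x ^ k) L)"
    by (simp add: sum_list_sum_nth len atLeast0LessThan)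
  also have "\<dots> = (\<Sum>x\<in>#proots (char_poly A). x ^ k)"
    unfolding m[symmetric] by (metis mset_map sum_mset_sum_list)
  finally show ?thesis using symmetric_trace_pow(2)[OF A] by simp
qed

lemma eig_antimono:
  assumes A: "A \<in> symmetric_mats n" and "1 \<le> i" "i \<le> j" "j \<le> n"
  shows "eig A j \<le> eig A i"
proof -
  define S where "S = sorted_list_of_multiset (proots (char_poly A))"
  have m: "mset S = proots (char_poly A)" by (simp add: S_def)
  have len: "length S = n" using symmetric_trace_pow(1)[OF A] m by (metis size_mset)
  have "sorted S" by (simp add: S_def)
  then have "S ! (n - j) \<le> S ! (n - i)"
    using assms len by (intro sorted_nth_mono) auto
  then show ?thesis
    using assms len by (simp add: eig_def S_def[symmetric] rev_nth Suc_diff_le)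
qed

lemma pow_mat_symmetric:
  assumes A: "A \<in> symmetric_mats n"
  shows "A ^\<^sub>m k \<in> symmetric_mats n"
proof (induction k)
  case 0
  show ?case using A by (auto simp: symmetric_mats_def)
next
  case (Suc k)
  have d: "A \<in> carrier_mat n n" "A ^\<^sub>m k \<in> carrier_mat n n" "transpose_mat A = A"
    "transpose_mat (A ^\<^sub>m k) = A ^\<^sub>m k"
    using A Suc by (auto simp: symmetric_mats_def)
  have comm: "A * A ^\<^sub>m k = A ^\<^sub>m k * A" 
    using d(1) by (induction k) (simp_all add: assoc_mult_mat[of _ n n _ n _ n, symmetric])
  have "transpose_mat (A ^\<^sub>m Suc k) = A * A ^\<^sub>m k"
    using d by (simp add: transpose_mult[of _ n n _ n])
  then show ?case using d comm by (auto simp: symmetric_mats_def)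
qed

lemma pow_mat_add:
  fixes A :: "'a :: semiring_1 mat"
  assumes A: "A \<in> carrier_mat n n"
  shows "A ^\<^sub>m (k + l) = A ^\<^sub>m k * A ^\<^sub>m l"
proof (induction l)
  case (Suc l)
  have "A ^\<^sub>m (k + Suc l) = (A ^\<^sub>m k * A ^\<^sub>m l) * A" using Suc by simp
  also have "\<dots> = A ^\<^sub>m k * A ^\<^sub>m Suc l"
    using A by (simp add: assoc_mult_mat[of _ n n _ n _ n])
  finally show ?case .
qed (use A in simp)

text \<open>
  Symmetry turns the squared Frobenius norm of \<open>A\<^sup>k\<close> into the trace of \<open>A\<^sup>2\<^sup>k\<close>. This is how the bounds
  on the eigenvalues control the entries of the powers of \<open>A\<close>.
\<close>

lemma symmetric_frobenius:
  assumes A: "A \<in> symmetric_mats n"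
  shows "(\<Sum>i<n. \<Sum>j<n. ((A ^\<^sub>m k) $$ (i, j))\<^sup>2) = (\<Sum>i=1..n. eig A i ^ (2 * k))"
proof -
  have B: "A ^\<^sub>m k \<in> symmetric_mats n" by (rule pow_mat_symmetric[OF A])
  then have Bc: "A ^\<^sub>m k \<in> carrier_mat n n" by (rule symmetric_mats_carrier)
  have "(\<Sum>i<n. \<Sum>j<n. ((A ^\<^sub>m k) $$ (i, j))\<^sup>2) = (\<Sum>i<n. (A ^\<^sub>m k * A ^\<^sub>m k) $$ (i, i))"
  proof (intro sum.cong refl)
    fix i assume "i \<in> {..<n}"
    then have i: "i < n" by simp
    show "(\<Sum>j<n. ((A ^\<^sub>m k) $$ (i, j))\<^sup>2) = (A ^\<^sub>m k * A ^\<^sub>m k) $$ (i, i)"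
      unfolding index_mult_mat_sum[OF Bc Bc i i] power2_eq_square
      by (intro sum.cong refl) (metis B i lessThan_iff symmetric_mats_entry)
  qed
  also have "\<dots> = mtrace (A ^\<^sub>m (k + k))"
    using symmetric_mats_carrier[OF A] Bc by (simp add: mtrace_def pow_mat_add[OF symmetric_mats_carrier[OF A]])
  finally show ?thesis using eig_sum_pow[OF A, of "2 * k"] by (simp flip: mult_2)
qed

section \<open>Fourth moments of the uniform distribution on the sphere\<close>

lemma space_vec_borel [simp]: "space (vec_borel n) = carrier_vec n"
  by (simp add: vec_borel_def)

lemma measurable_vec_borel_component [measurable]:
  assumes "i < n"
  shows "(\<lambda>x. x $ i) \<in> borel_measurable (vec_borel n)"
proof -
  have "(\<lambda>x. \<lambda>i\<in>{..<n}. x $ i) \<in> measurable (vec_borel n) (\<Pi>\<^sub>M i\<in>{..<n}. (borel :: real measure))"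
    unfolding vec_borel_def by (rule measurable_vimage_algebra1) (auto simp: space_PiM)
  from measurable_compose[OF this measurable_component_singleton[of i "{..<n}" "\<lambda>_. borel"]]
  show ?thesis using assms by simp
qed

lemma measurable_vec_borelI:
  assumes "\<And>x. x \<in> space N \<Longrightarrow> f x \<in> carrier_vec n"
    and "\<And>i. i < n \<Longrightarrow> (\<lambda>x. f x $ i) \<in> borel_measurable N"
  shows "f \<in> measurable N (vec_borel n)"
  unfolding vec_borel_def
proof (rule measurable_vimage_algebra2)
  show "f \<in> space N \<rightarrow> carrier_vec n" using assms(1) by auto
  show "(\<lambda>x. \<lambda>i\<in>{..<n}. f x $ i) \<in> measurable N (\<Pi>\<^sub>M i\<in>{..<n}. borel)"
    using assms(2) by (intro measurable_restrict) auto
qed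

lemma vnorm_eq: "x \<in> carrier_vec n \<Longrightarrow> vnorm x = sqrt (\<Sum>i<n. (x $ i)\<^sup>2)"
  by (simp add: vnorm_def scalar_prod_def atLeast0LessThan power2_eq_square)

lemma vnorm_nonneg: "vnorm x \<ge> 0"
  unfolding vnorm_def scalar_prod_def by (auto intro!: sum_nonneg)

lemma vnorm_smult:
  assumes "x \<in> carrier_vec n"
  shows "vnorm (c \<cdot>\<^sub>v x) = \<bar>c\<bar> * vnorm x"
proof -
  have "c \<cdot>\<^sub>v x \<in> carrier_vec n" using assms by simp
  then have "vnorm (c \<cdot>\<^sub>v x) = sqrt (\<Sum>i<n. c\<^sup>2 * (x $ i)\<^sup>2)"
    using assms by (simp add: vnorm_eq power_mult_distrib)
  then show ?thesis using assms
    by (simp add: vnorm_eq real_sqrt_mult flip: sum_distrib_left)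
qed

lemma borel_measurable_vnorm [measurable]: "vnorm \<in> borel_measurable (vec_borel n)"
proof -
  have "(\<lambda>x. sqrt (\<Sum>i<n. (x $ i)\<^sup>2)) \<in> borel_measurable (vec_borel n)"
    by measurable
  then show ?thesis
    by (rule measurable_cong[THEN iffD2, rotated]) (simp add: vnorm_eq)
qed

text \<open>
  Maps that change one coordinate by \<open>x\<^sub>i \<mapsto> s x\<^sub>i + c x\<^sub>j\<close>. For \<open>\<bar>s\<bar> = 1\<close> they preserve volume by a
  one-dimensional affine substitution, and the sign changes and plane reflections used below are
  compositions of them.
\<close>

definition shear :: "nat \<Rightarrow> nat \<Rightarrow> nat \<Rightarrow> real \<Rightarrow> real \<Rightarrow> real vec \<Rightarrow> real vec" where
  "shear n i j s c x = vec n (\<lambda>k. if k = i then s * x $ i + c * x $ j else x $ k)"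

lemma measurable_shear [measurable]:
  assumes "i < n" "j < n"
  shows "shear n i j s c \<in> measurable (vec_borel n) (vec_borel n)"
proof (rule measurable_vec_borelI)
  fix k assume "k < n"
  then show "(\<lambda>x. shear n i j s c x $ k) \<in> borel_measurable (vec_borel n)"
    using assms unfolding shear_def by (cases "k = i") simp_all
qed (simp add: shear_def)

lemma measurable_PiM_lborel_component:
  "k < n \<Longrightarrow> (\<lambda>x. x k) \<in> borel_measurable (\<Pi>\<^sub>M i\<in>{..<n}. (lborel :: real measure))"
  using measurable_component_singleton[of k "{..<n}" "\<lambda>_. lborel :: real measure"] by simp

lemma measurable_PiM_lborel_shear:
  assumes "i < n" "j < n"
  shows "(\<lambda>x :: nat \<Rightarrow> real. x(i := s * x i + c * x j))
    \<in> measurable (\<Pi>\<^sub>M i\<in>{..<n}. lborel) (\<Pi>\<^sub>M i\<in>{..<n}. lborel)"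
proof (rule measurable_fun_upd)
  show "{..<n} = {..<n} \<union> {i}" using assms by auto
  show "(\<lambda>x :: nat \<Rightarrow> real. s * x i + c * x j) \<in> measurable (\<Pi>\<^sub>M i\<in>{..<n}. lborel) lborel"
    using assms by (auto intro!: borel_measurable_add borel_measurable_times measurable_PiM_lborel_component)
qed simp

lemma PiM_lborel_shear:
  fixes s c :: real and n i j :: nat
  assumes ij: "i < n" "j < n" "i \<noteq> j" and s: "\<bar>s\<bar> = 1"
  defines "P \<equiv> (\<Pi>\<^sub>M i\<in>{..<n}. (lborel :: real measure))"
  shows "distr P P (\<lambda>x. x(i := s * x i + c * x j)) = P"
proof (rule measure_eqI)
  let ?T = "\<lambda>x :: nat \<Rightarrow> real. x(i := s * x i + c * x j)"
  interpret product_sigma_finite "\<lambda>_ :: nat. lborel :: real measure" ..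
  fix A assume "A \<in> sets (distr P P ?T)"
  then have A[measurable]: "A \<in> sets P" by simp
  have T[measurable]: "?T \<in> measurable P P"
    unfolding P_def by (rule measurable_PiM_lborel_shear) fact+
  \<comment> \<open>Fubini isolates the coordinate \<open>i\<close>; given the others, the map is an affine map of the line.\<close>
  let ?I = "{..<n} - {i}"
  let ?Q = "\<Pi>\<^sub>M i\<in>?I. (lborel :: real measure)"
  have ins: "insert i ?I = {..<n}" using assms by auto
  have split: "(\<integral>\<^sup>+x. f x \<partial>P) = (\<integral>\<^sup>+x. \<integral>\<^sup>+y. f (x(i := y)) \<partial>lborel \<partial>?Q)"
    if "f \<in> borel_measurable P" for f
    using product_nn_integral_insert[of ?I i f] that unfolding P_def ins by simp
  have "emeasure (distr P P ?T) A = (\<integral>\<^sup>+x. indicator A x \<partial>distr P P ?T)"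
    by simp
  also have "\<dots> = (\<integral>\<^sup>+x. indicator A (?T x) \<partial>P)"
    by (rule nn_integral_distr[OF T]) auto
  also have "\<dots> = (\<integral>\<^sup>+x. \<integral>\<^sup>+y. indicator A (?T (x(i := y))) \<partial>lborel \<partial>?Q)"
    by (rule split) measurable
  also have "\<dots> = (\<integral>\<^sup>+x. \<integral>\<^sup>+y. indicator A (x(i := c * x j + s * y)) \<partial>lborel \<partial>?Q)"
    using ij by (simp add: add.commute)
  also have "\<dots> = (\<integral>\<^sup>+x. \<integral>\<^sup>+y. indicator A (x(i := y)) \<partial>lborel \<partial>?Q)"
  proof (rule nn_integral_cong)
    fix x assume "x \<in> space ?Q"
    then have "(\<lambda>y. x(i := y)) \<in> measurable lborel P"
      unfolding P_def using ij by (intro measurable_fun_upd[where J = ?I]) auto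
    then have [measurable]: "(\<lambda>y. x(i := y)) \<in> measurable borel P" by simp
    have "(\<integral>\<^sup>+y. indicator A (x(i := y)) \<partial>lborel)
      = \<bar>s\<bar> * (\<integral>\<^sup>+y. indicator A (x(i := c * x j + s * y)) \<partial>lborel)"
      using s by (intro nn_integral_real_affine) auto
    then show "(\<integral>\<^sup>+y. indicator A (x(i := c * x j + s * y)) \<partial>lborel)
      = (\<integral>\<^sup>+y. indicator A (x(i := y)) \<partial>lborel)"
      using s by simp
  qed
  also have "\<dots> = (\<integral>\<^sup>+x. indicator A x \<partial>P)"
    by (rule split[symmetric]) measurable
  finally show "emeasure (distr P P ?T) A = emeasure P A" by simp
qed simp

lemma measurable_vec_PiM [measurable]:
  "vec n \<in> measurable (\<Pi>\<^sub>M i\<in>{..<n}. (lborel :: real measure)) (vec_borel n)"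
proof (rule measurable_vec_borelI)
  fix i assume "i < n"
  then show "(\<lambda>x. vec n x $ i) \<in> borel_measurable (\<Pi>\<^sub>M i\<in>{..<n}. (lborel :: real measure))"
    using measurable_PiM_lborel_component[of i n] by simp
qed simp

lemma sets_vec_lborel [simp, measurable_cong]: "sets (vec_lborel n) = sets (vec_borel n)"
  by (simp add: vec_lborel_def)

lemma space_vec_lborel [simp]: "space (vec_lborel n) = carrier_vec n"
  by (simp add: vec_lborel_def)

lemma sets_uniform_sphere [simp, measurable_cong]: "sets (uniform_sphere n) = sets (vec_borel n)"
  by (simp add: uniform_sphere_def)

lemma space_uniform_sphere [simp]: "space (uniform_sphere n) = carrier_vec n"
  by (simp add: uniform_sphere_def)

lemma vec_lborel_shear:
  assumes "i < n" "j < n" "i \<noteq> j" "\<bar>s\<bar> = 1"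
  shows "distr (vec_lborel n) (vec_borel n) (shear n i j s c) = vec_lborel n"
proof -
  let ?P = "\<Pi>\<^sub>M i\<in>{..<n}. (lborel :: real measure)"
  let ?T = "\<lambda>x :: nat \<Rightarrow> real. x(i := s * x i + c * x j)"
  have T: "?T \<in> measurable ?P ?P" using assms by (intro measurable_PiM_lborel_shear)
  have "distr (vec_lborel n) (vec_borel n) (shear n i j s c)
    = distr ?P (vec_borel n) (\<lambda>x. shear n i j s c (vec n x))"
    unfolding vec_lborel_def using assms by (subst distr_distr) (auto simp: comp_def)
  also have "(\<lambda>x. shear n i j s c (vec n x)) = (\<lambda>x. vec n (?T x))"
    using assms by (intro ext eq_vecI) (auto simp: shear_def)
  also have "distr ?P (vec_borel n) (\<lambda>x. vec n (?T x)) = distr (distr ?P ?P ?T) (vec_borel n) (vec n)"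
    by (subst distr_distr[OF measurable_vec_PiM T]) (simp add: comp_def)
  also have "distr ?P ?P ?T = ?P" using assms by (rule PiM_lborel_shear)
  finally show ?thesis by (simp add: vec_lborel_def)
qed

lemma measurable_normalize [measurable]:
  "(\<lambda>x. (1 / vnorm x) \<cdot>\<^sub>v x) \<in> measurable (vec_borel n) (vec_borel n)"
proof (rule measurable_vec_borelI)
  fix i assume [simp]: "i < n"
  have "(\<lambda>x. (1 / vnorm x) * x $ i) \<in> borel_measurable (vec_borel n)" by measurable
  then show "(\<lambda>x. ((1 / vnorm x) \<cdot>\<^sub>v x) $ i) \<in> borel_measurable (vec_borel n)"
    by (rule measurable_cong[THEN iffD2, rotated]) auto
qed simp

lemma unit_ball_sets [measurable]: "{x \<in> carrier_vec n. vnorm x \<le> 1} \<in> sets (vec_borel n)"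
proof -
  have "{x \<in> space (vec_borel n). vnorm x \<le> 1} \<in> sets (vec_borel n)" by measurable
  then show ?thesis by simp
qed

text \<open>
  A norm-preserving, homogeneous and volume-preserving map leaves the unit ball invariant and
  commutes with the radial projection, hence preserves the cone measure.
\<close>

lemma uniform_sphere_invariant:
  assumes T[measurable]: "T \<in> measurable (vec_borel n) (vec_borel n)"
    and vol: "distr (vec_lborel n) (vec_borel n) T = vec_lborel n"
    and norm: "\<And>x. x \<in> carrier_vec n \<Longrightarrow> vnorm (T x) = vnorm x"
    and hom: "\<And>x c. x \<in> carrier_vec n \<Longrightarrow> T (c \<cdot>\<^sub>v x) = c \<cdot>\<^sub>v T x"
  shows "distr (uniform_sphere n) (vec_borel n) T = uniform_sphere n"
proof -
  let ?B = "{x \<in> carrier_vec n. vnorm x \<le> 1}"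
  let ?U = "uniform_measure (vec_lborel n) ?B"
  let ?N = "\<lambda>x. (1 / vnorm x) \<cdot>\<^sub>v x"
  have TC: "T x \<in> carrier_vec n" if "x \<in> carrier_vec n" for x
    using measurable_space[OF T] that by simp
  have inv: "distr ?U (vec_borel n) T = ?U"
  proof (rule measure_eqI)
    fix A assume "A \<in> sets (distr ?U (vec_borel n) T)"
    then have A[measurable]: "A \<in> sets (vec_borel n)" by simp
    have "emeasure (distr ?U (vec_borel n) T) A = emeasure ?U (T -` A \<inter> carrier_vec n)"
      by (subst emeasure_distr) auto
    also have "\<dots> = emeasure (vec_lborel n) (?B \<inter> (T -` A \<inter> carrier_vec n)) / emeasure (vec_lborel n) ?B"
      using measurable_sets[OF T A] by (intro emeasure_uniform_measure) auto
    also have "?B \<inter> (T -` A \<inter> carrier_vec n) = T -` (?B \<inter> A) \<inter> carrier_vec n"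
      using TC norm by auto
    also have "emeasure (vec_lborel n) \<dots> = emeasure (distr (vec_lborel n) (vec_borel n) T) (?B \<inter> A)"
      by (subst emeasure_distr) auto
    also have "\<dots> / emeasure (vec_lborel n) ?B = emeasure ?U A"
      unfolding vol by (subst emeasure_uniform_measure) auto
    finally show "emeasure (distr ?U (vec_borel n) T) A = emeasure ?U A" .
  qed simp
  have "distr (uniform_sphere n) (vec_borel n) T = distr ?U (vec_borel n) (T \<circ> ?N)"
    unfolding uniform_sphere_def by (rule distr_distr) auto
  also have "\<dots> = distr ?U (vec_borel n) (?N \<circ> T)"
    by (intro distr_cong) (auto simp: hom norm)
  also have "\<dots> = distr (distr ?U (vec_borel n) T) (vec_borel n) ?N"
    by (rule distr_distr[symmetric]) auto
  also have "\<dots> = uniform_sphere n" unfolding inv by (simp add: uniform_sphere_def)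
  finally show ?thesis .
qed

text \<open>
  The radial projection sends the origin to itself, so unit length fails there. The origin lies in
  the null set where the first coordinate vanishes.
\<close>

lemma AE_uniform_sphere_vnorm:
  assumes n: "n \<ge> 1"
  shows "AE x in uniform_sphere n. vnorm x = 1"
proof -
  interpret product_sigma_finite "\<lambda>_. lborel :: real measure" ..
  let ?P = "\<Pi>\<^sub>M i\<in>{..<n}. (lborel :: real measure)"
  have "emeasure ?P (\<Pi>\<^sub>E i\<in>{..<n}. if i = 0 then {0} else UNIV)
    = (\<Prod>i<n. emeasure lborel (if i = 0 then {0 :: real} else UNIV))"
    by (intro emeasure_PiM) auto
  also have "\<dots> = 0" using n by (intro prod_zero) (auto intro!: bexI[of _ 0])
  finally have "AE x in ?P. x 0 \<noteq> 0"
    by (intro AE_I[of _ _ "\<Pi>\<^sub>E i\<in>{..<n}. if i = 0 then {0} else UNIV"])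
       (auto simp: space_PiM PiE_iff sets_PiM_I_finite extensional_def)
  then have "AE x in ?P. vnorm (vec n x) \<noteq> 0"
  proof (rule AE_mp, intro AE_I2 impI)
    fix x :: "nat \<Rightarrow> real" assume "x 0 \<noteq> 0"
    moreover have "(x 0)\<^sup>2 \<le> (\<Sum>i<n. (x i)\<^sup>2)"
      using n by (intro member_le_sum) auto
    ultimately have "(\<Sum>i<n. (x i)\<^sup>2) \<noteq> 0"
      by (smt (verit) zero_less_power2)
    then show "vnorm (vec n x) \<noteq> 0" by (simp add: vnorm_eq[of _ n])
  qed
  moreover have "{x \<in> space (vec_borel n). vnorm x \<noteq> 0} \<in> sets (vec_borel n)" by measurable
  ultimately have "AE x in vec_lborel n. vnorm x \<noteq> 0"
    unfolding vec_lborel_def by (subst AE_distr_iff) auto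
  then have "AE x in uniform_measure (vec_lborel n) {x \<in> carrier_vec n. vnorm x \<le> 1}. vnorm x \<noteq> 0"
    by (intro AE_uniform_measureI) auto
  then have "AE x in uniform_measure (vec_lborel n) {x \<in> carrier_vec n. vnorm x \<le> 1}.
      vnorm ((1 / vnorm x) \<cdot>\<^sub>v x) = 1"
  proof (rule AE_mp, intro AE_I2 impI)
    fix x assume "x \<in> space (uniform_measure (vec_lborel n) {x \<in> carrier_vec n. vnorm x \<le> 1})"
      and "vnorm x \<noteq> 0"
    then show "vnorm ((1 / vnorm x) \<cdot>\<^sub>v x) = 1"
      using vnorm_nonneg[of x] by (simp add: vnorm_smult[of _ n])
  qed
  moreover have "{x \<in> space (vec_borel n). vnorm x = 1} \<in> sets (vec_borel n)" by measurable
  ultimately show ?thesis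
    unfolding uniform_sphere_def by (subst AE_distr_iff) auto
qed

lemma uniform_sphere_flip:
  assumes i: "i < n" and n: "n \<ge> 2"
  shows "distr (uniform_sphere n) (vec_borel n) (shear n i j (-1) 0) = uniform_sphere n"
proof -
  \<comment> \<open>The second index has coefficient \<open>0\<close>, so it may be replaced by any index other than \<open>i\<close>.\<close>
  define j' where "j' = (if i = 0 then 1 else 0 :: nat)"
  have j': "j' < n" "i \<noteq> j'" using n by (auto simp: j'_def)
  have eq: "shear n i j (-1) 0 = shear n i j' (-1) 0" by (auto simp: shear_def fun_eq_iff)
  show ?thesis unfolding eq
  proof (rule uniform_sphere_invariant)
    show "shear n i j' (-1) 0 \<in> measurable (vec_borel n) (vec_borel n)"
      using i j' by (intro measurable_shear)
    show "distr (vec_lborel n) (vec_borel n) (shear n i j' (-1) 0) = vec_lborel n"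
      using i j' by (intro vec_lborel_shear) auto
    fix x :: "real vec" assume x: "x \<in> carrier_vec n"
    have "(shear n i j' (-1) 0 x $ k)\<^sup>2 = (x $ k)\<^sup>2" if "k < n" for k
      using that by (simp add: shear_def)
    moreover have "shear n i j' (-1) 0 x \<in> carrier_vec n" by (simp add: shear_def)
    ultimately show "vnorm (shear n i j' (-1) 0 x) = vnorm x"
      using x by (simp add: vnorm_eq)
    fix c :: real
    show "shear n i j' (-1) 0 (c \<cdot>\<^sub>v x) = c \<cdot>\<^sub>v shear n i j' (-1) 0 x"
      using x i j' by (intro eq_vecI) (auto simp: shear_def)
  qed
qed

text \<open>
  The reflection of the plane of the coordinates \<open>i\<close> and \<open>j\<close> in the line at angle \<open>\<pi>/8\<close>. Being norm
  preserving, it yields the relation \<open>E v\<^sub>i\<^sup>4 = 3 E v\<^sub>i\<^sup>2 v\<^sub>j\<^sup>2\<close> and thereby determines all fourth moments.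
\<close>

definition mix :: "nat \<Rightarrow> nat \<Rightarrow> nat \<Rightarrow> real vec \<Rightarrow> real vec" where
  "mix n i j x = vec n (\<lambda>k. if k = i then (x $ i + x $ j) / sqrt 2
     else if k = j then (x $ i - x $ j) / sqrt 2 else x $ k)"

text \<open>
  The lifting scheme: a plane orthogonal map as three shears, one of which carries the determinant
  \<open>-1\<close>. Volume preservation of the reflection follows from this factorisation.
\<close>

lemma mix_eq_shears:
  assumes "i < n" "j < n" "i \<noteq> j"
  shows "mix n i j = shear n i j 1 (1 - sqrt 2) \<circ> shear n j i (-1) (1 / sqrt 2) \<circ> shear n i j 1 (sqrt 2 - 1)"
proof
  fix x :: "real vec"
  define r :: real where "r = sqrt 2"
  have r: "r * r = 2" "r \<noteq> 0" by (auto simp: r_def)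
  define x1 where "x1 = shear n i j 1 (r - 1) x"
  define x2 where "x2 = shear n j i (-1) (1 / r) x1"
  have x1: "x1 $ i = x $ i + (r - 1) * x $ j" "x1 $ j = x $ j"
    using assms by (simp_all add: x1_def shear_def)
  have "x2 $ j = - x1 $ j + (1 / r) * x1 $ i" using assms by (simp add: x2_def shear_def)
  also have "\<dots> = (x $ i - x $ j) / r" unfolding x1 using r(2) by (simp add: field_simps)
  finally have x2j: "x2 $ j = (x $ i - x $ j) / r" .
  have x2i: "x2 $ i = x $ i + (r - 1) * x $ j" using assms x1 by (simp add: x2_def shear_def)
  have "r * (x2 $ i + (1 - r) * x2 $ j) = r * x $ i + (r * r - r) * x $ j + (1 - r) * (x $ i - x $ j)"
    unfolding x2i x2j using r(2) by (simp add: field_simps)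
  also have "\<dots> = x $ i + x $ j" unfolding r(1) by (simp add: algebra_simps)
  finally have x3: "x2 $ i + (1 - r) * x2 $ j = (x $ i + x $ j) / r"
    using r(2) by (simp add: eq_divide_eq mult.commute)
  have "mix n i j x = shear n i j 1 (1 - r) x2"
  proof (intro eq_vecI)
    fix k assume "k < dim_vec (shear n i j 1 (1 - r) x2)"
    then have k: "k < n" by (simp add: shear_def)
    have other: "x2 $ k = x $ k" if "k \<noteq> i" "k \<noteq> j"
      using that k by (simp add: x2_def x1_def shear_def)
    show "mix n i j x $ k = shear n i j 1 (1 - r) x2 $ k"
      using k x3 x2j other assms by (simp add: mix_def shear_def r_def)
  qed (simp add: mix_def shear_def)
  then show "mix n i j x
    = (shear n i j 1 (1 - sqrt 2) \<circ> shear n j i (-1) (1 / sqrt 2) \<circ> shear n i j 1 (sqrt 2 - 1)) x"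
    by (simp add: x2_def x1_def r_def)
qed

lemma measurable_mix:
  assumes "i < n" "j < n" "i \<noteq> j"
  shows "mix n i j \<in> measurable (vec_borel n) (vec_borel n)"
  unfolding mix_eq_shears[OF assms] comp_def using assms by measurable

lemma uniform_sphere_mix:
  assumes ij: "i < n" "j < n" "i \<noteq> j"
  shows "distr (uniform_sphere n) (vec_borel n) (mix n i j) = uniform_sphere n"
proof (rule uniform_sphere_invariant)
  note [measurable] = measurable_shear[OF ij(1,2)] measurable_shear[OF ij(2,1)]
  show "mix n i j \<in> measurable (vec_borel n) (vec_borel n)" by (rule measurable_mix[OF ij])
  have V: "distr (vec_lborel n) (vec_borel n) (f \<circ> g) = vec_lborel n"
    if "f \<in> measurable (vec_borel n) (vec_borel n)" "g \<in> measurable (vec_borel n) (vec_borel n)"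
       "distr (vec_lborel n) (vec_borel n) f = vec_lborel n"
       "distr (vec_lborel n) (vec_borel n) g = vec_lborel n" for f g
  proof -
    have "distr (distr (vec_lborel n) (vec_borel n) g) (vec_borel n) f
      = distr (vec_lborel n) (vec_borel n) (f \<circ> g)"
      using that(1,2) by (intro distr_distr) auto
    then show ?thesis using that(3,4) by simp
  qed
  show "distr (vec_lborel n) (vec_borel n) (mix n i j) = vec_lborel n"
    unfolding mix_eq_shears[OF ij]
    by (intro V measurable_comp[where N = "vec_borel n"] vec_lborel_shear measurable_shear)
       (use ij in auto)
  fix x :: "real vec" assume x: "x \<in> carrier_vec n"
  have m: "mix n i j x \<in> carrier_vec n" by (simp add: mix_def)
  have rest: "(\<Sum>k<n. (y $ k)\<^sup>2) = (y $ i)\<^sup>2 + (y $ j)\<^sup>2 + (\<Sum>k\<in>{..<n} - {i, j}. (y $ k)\<^sup>2)" for y :: "real vec"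
  proof -
    have "{..<n} = insert i (insert j ({..<n} - {i, j}))" using ij by auto
    then have "(\<Sum>k<n. (y $ k)\<^sup>2) = (\<Sum>k\<in>insert i (insert j ({..<n} - {i, j})). (y $ k)\<^sup>2)" by simp
    then show ?thesis using ij by simp
  qed
  have "((x $ i + x $ j) / sqrt 2)\<^sup>2 + ((x $ i - x $ j) / sqrt 2)\<^sup>2 = (x $ i)\<^sup>2 + (x $ j)\<^sup>2"
    by (simp add: power_divide power2_eq_square field_simps)
  then have "(\<Sum>k<n. (mix n i j x $ k)\<^sup>2) = (\<Sum>k<n. (x $ k)\<^sup>2)"
    unfolding rest using ij by (simp add: mix_def)
  then show "vnorm (mix n i j x) = vnorm x" using x m by (simp add: vnorm_eq)
  fix c :: real
  show "mix n i j (c \<cdot>\<^sub>v x) = c \<cdot>\<^sub>v mix n i j x"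
    using x ij by (intro eq_vecI) (auto simp: mix_def algebra_simps add_divide_distrib diff_divide_distrib)
qed

lemma component_le_vnorm:
  assumes "x \<in> carrier_vec n" "i < n"
  shows "\<bar>x $ i\<bar> \<le> vnorm x"
proof -
  have "(x $ i)\<^sup>2 \<le> (\<Sum>k<n. (x $ k)\<^sup>2)" using assms by (intro member_le_sum) auto
  from real_sqrt_le_mono[OF this] show ?thesis
    unfolding vnorm_eq[OF assms(1)] real_sqrt_abs .
qed

context
  fixes n :: nat and U :: "real vec measure"
  assumes n: "n \<ge> 2"
  defines "U \<equiv> uniform_sphere n"
  assumes prob: "prob_space U"
begin

lemma sphere_component_bound: "i < n \<Longrightarrow> AE x in U. \<bar>x $ i\<bar> \<le> 1"
  unfolding U_def
  by (rule AE_mp[OF AE_uniform_sphere_vnorm]) 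
     (use n in \<open>auto simp: U_def intro!: AE_I2 dest: component_le_vnorm\<close>, metis component_le_vnorm)

definition moment4 where "moment4 i j k l = (\<integral>x. x $ i * x $ j * x $ k * x $ l \<partial>U)"

lemma sphere_integrable:
  assumes "i < n" "j < n" "k < n" "l < n"
  shows "integrable U (\<lambda>x. x $ i * x $ j * x $ k * x $ l)"
proof -
  interpret prob_space U by (rule prob)
  show ?thesis
  proof (rule integrable_const_bound[where B = 1])
    show "AE x in U. norm (x $ i * x $ j * x $ k * x $ l) \<le> 1"
      using sphere_component_bound[OF assms(1)] sphere_component_bound[OF assms(2)]
        sphere_component_bound[OF assms(3)] sphere_component_bound[OF assms(4)]
    proof eventually_elim
      case (elim x)
      then show ?case unfolding real_norm_def abs_mult
        by (intro mult_le_one mult_nonneg_nonneg abs_ge_zero)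
    qed
    show "(\<lambda>x. x $ i * x $ j * x $ k * x $ l) \<in> borel_measurable U"
      unfolding U_def using assms by measurable
  qed
qed

lemma moment4_odd:
  assumes l: "i < n" "j < n" "k < n" "l < n" and i: "i \<notin> {j, k, l}"
  shows "moment4 i j k l = 0"
proof -
  have [measurable]: "shear n i j (-1) 0 \<in> measurable (vec_borel n) (vec_borel n)"
    using l by (intro measurable_shear)
  have "moment4 i j k l = (\<integral>x. x $ i * x $ j * x $ k * x $ l \<partial>distr U (vec_borel n) (shear n i j (-1) 0))"
    unfolding moment4_def U_def using uniform_sphere_flip[OF l(1) n] by simp
  also have "\<dots> = (\<integral>x. (shear n i j (-1) 0 x) $ i * (shear n i j (-1) 0 x) $ j * (shear n i j (-1) 0 x) $ k
      * (shear n i j (-1) 0 x) $ l \<partial>U)"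
    unfolding U_def using l by (intro integral_distr) (auto intro!: borel_measurable_times measurable_vec_borel_component)
  also have "\<dots> = - moment4 i j k l"
    unfolding moment4_def using l i by (auto simp: shear_def)
  finally show ?thesis by simp
qed

lemma moment4_perm:
  "moment4 i j k l = moment4 j i k l" "moment4 i j k l = moment4 i k j l" "moment4 i j k l = moment4 i j l k"
  unfolding moment4_def by (simp_all add: mult_ac)

text \<open>
  Expanding \<open>((v\<^sub>i \<plusminus> v\<^sub>j) / \<surd>2)\<^sup>4\<close>, in which the odd terms integrate to zero, and using that its
  integral is \<open>E v\<^sub>i\<^sup>4\<close> for one sign and \<open>E v\<^sub>j\<^sup>4\<close> for the other.
\<close>

lemma moment4_mix:
  assumes l: "i < n" "j < n" and ij: "i \<noteq> j"
  shows "moment4 i i i i = 3 * moment4 i i j j" "moment4 j j j j = moment4 i i i i"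
proof -
  have "moment4 i i i j = moment4 j i i i"
    using moment4_perm(3)[of i i i j] moment4_perm(2)[of i i j i] moment4_perm(1)[of i j i i] by simp
  then have odd: "moment4 i i i j = 0" "moment4 i j j j = 0"
    using moment4_odd[of j i i i] moment4_odd[of i j j j] l ij by auto
  have four: "sqrt 2 ^ 4 = (4 :: real)"
    by (simp add: power4_eq_xxxx mult.assoc)
  note int = sphere_integrable
  have fourth: "moment4 k k k k = (\<integral>x. (mix n i j x $ k) ^ 4 \<partial>U)" if "k < n" for k
  proof -
    have "moment4 k k k k = (\<integral>x. (x $ k) ^ 4 \<partial>distr U (vec_borel n) (mix n i j))"
      unfolding moment4_def U_def uniform_sphere_mix[OF l ij] by (simp add: power4_eq_xxxx)
    also have "\<dots> = (\<integral>x. (mix n i j x $ k) ^ 4 \<partial>U)"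
      unfolding U_def using that measurable_mix[OF l ij]
      by (intro integral_distr) (auto intro!: borel_measurable_power measurable_vec_borel_component)
    finally show ?thesis .
  qed
  have expand: "(\<integral>x. ((x $ i + s * x $ j) / sqrt 2) ^ 4 \<partial>U) = (moment4 i i i i + 6 * moment4 i i j j + moment4 j j j j) / 4"
    if s: "s = 1 \<or> s = -1" for s :: real
  proof -
    have *: "((x $ i + s * x $ j) / sqrt 2) ^ 4
      = (x $ i * x $ i * x $ i * x $ i + 4 * s * (x $ i * x $ i * x $ i * x $ j)
         + 6 * (x $ i * x $ i * x $ j * x $ j) + 4 * s * (x $ i * x $ j * x $ j * x $ j)
         + x $ j * x $ j * x $ j * x $ j) / 4" for x :: "real vec"
    proof -
      have "(y + z) ^ 4 = y * y * y * y + 4 * (y * y * y * z) + 6 * (y * y * z * z)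
          + 4 * (y * z * z * z) + z * z * z * z"
        "(y - z) ^ 4 = y * y * y * y - 4 * (y * y * y * z) + 6 * (y * y * z * z)
          - 4 * (y * z * z * z) + z * z * z * z" for y z :: real
        by (simp_all add: power4_eq_xxxx algebra_simps)
      then show ?thesis using s by (elim disjE) (simp_all add: power_divide four)
    qed
    have "(\<integral>x. ((x $ i + s * x $ j) / sqrt 2) ^ 4 \<partial>U)
      = (moment4 i i i i + 4 * s * moment4 i i i j + 6 * moment4 i i j j + 4 * s * moment4 i j j j + moment4 j j j j) / 4"
      unfolding moment4_def * using l by (simp add: int)
    then show ?thesis by (simp add: odd)
  qed
  have a: "moment4 i i i i = (moment4 i i i i + 6 * moment4 i i j j + moment4 j j j j) / 4"
    using fourth[OF l(1)] expand[of 1] l ij by (simp add: mix_def)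
  have b: "moment4 j j j j = (moment4 i i i i + 6 * moment4 i i j j + moment4 j j j j) / 4"
    using fourth[OF l(2)] expand[of "-1"] l ij by (simp add: mix_def)
  show "moment4 j j j j = moment4 i i i i" using a b by simp
  then show "moment4 i i i i = 3 * moment4 i i j j" using a by simp
qed

text \<open>
  All fourth moments are now multiples of a single one, which is found by integrating
  \<open>(\<Sum>\<^sub>i v\<^sub>i\<^sup>2)\<^sup>2 = 1\<close>.
\<close>

lemma moment4_value:
  assumes "i < n" "j < n"
  shows "moment4 i i j j = (if i = j then 3 else 1) / (real n * (real n + 2))"
proof -
  interpret prob_space U by (rule prob)
  define \<alpha> where "\<alpha> = moment4 0 0 0 0"
  have diag: "moment4 i i i i = \<alpha>" if "i < n" for i
    using moment4_mix(2)[of 0 i] that n by (cases "i = 0") (auto simp: \<alpha>_def)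
  have val: "moment4 i i j j = (if i = j then 3 else 1) * \<alpha> / 3" if "i < n" "j < n" for i j
    using moment4_mix(1)[of i j] diag that by auto
  have "(\<Sum>i<n. \<Sum>j<n. moment4 i i j j) = (\<integral>x. (\<Sum>i<n. \<Sum>j<n. x $ i * x $ i * x $ j * x $ j) \<partial>U)"
  proof -
    have "(\<integral>x. (\<Sum>i<n. \<Sum>j<n. x $ i * x $ i * x $ j * x $ j) \<partial>U)
      = (\<Sum>i<n. \<integral>x. (\<Sum>j<n. x $ i * x $ i * x $ j * x $ j) \<partial>U)"
      by (rule Bochner_Integration.integral_sum) (auto intro!: integrable_sum sphere_integrable)
    also have "\<dots> = (\<Sum>i<n. \<Sum>j<n. moment4 i i j j)"
      unfolding moment4_def
      by (intro sum.cong refl Bochner_Integration.integral_sum) (auto intro!: sphere_integrable)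
    finally show ?thesis by simp
  qed
  also have "\<dots> = (\<integral>x. 1 \<partial>U)"
  proof (rule integral_cong_AE)
    have "AE x in U. vnorm x = 1" unfolding U_def using n by (intro AE_uniform_sphere_vnorm) auto
    then show "AE x in U. (\<Sum>i<n. \<Sum>j<n. x $ i * x $ i * x $ j * x $ j) = 1"
    proof (rule AE_mp, intro AE_I2 impI)
      fix x assume "x \<in> space U" "vnorm x = 1"
      then have "(\<Sum>k<n. (x $ k)\<^sup>2) = 1" by (simp add: U_def vnorm_eq)
      moreover have "(\<Sum>i<n. \<Sum>j<n. x $ i * x $ i * x $ j * x $ j) = (\<Sum>k<n. (x $ k)\<^sup>2) * (\<Sum>k<n. (x $ k)\<^sup>2)"
        by (simp add: sum_product power2_eq_square mult.assoc)
      ultimately show "(\<Sum>i<n. \<Sum>j<n. x $ i * x $ i * x $ j * x $ j) = 1" by simp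
    qed
    show "(\<lambda>x. \<Sum>i<n. \<Sum>j<n. x $ i * x $ i * x $ j * x $ j) \<in> borel_measurable U"
      unfolding U_def by (intro borel_measurable_sum borel_measurable_times) 
        (auto intro: measurable_vec_borel_component)
  qed simp
  also have "\<dots> = 1" by (simp add: prob_space)
  finally have "1 = (\<Sum>i<n. \<Sum>j<n. moment4 i i j j)" by simp
  also have "\<dots> = (\<Sum>i<n. \<Sum>j<n. (if i = j then 3 else 1) * \<alpha> / 3)"
    by (intro sum.cong refl val) auto
  also have "\<dots> = (\<Sum>i<n. \<Sum>j<n. (\<alpha> / 3 + (if i = j then 2 * \<alpha> / 3 else 0)))"
    by (intro sum.cong) auto
  also have "\<dots> = real n * (real n + 2) * (\<alpha> / 3)"
    by (simp add: sum.distrib algebra_simps)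
  finally have "1 = real n * (real n + 2) * (\<alpha> / 3)" .
  moreover have "real n * (real n + 2) \<noteq> 0" using n by simp
  ultimately have eq: "\<alpha> / 3 = 1 / (real n * (real n + 2))"
    by (metis nonzero_mult_div_cancel_left)
  have "moment4 i i j j = (if i = j then 3 else 1) * (\<alpha> / 3)" using val[OF assms] by simp
  then show ?thesis unfolding eq by simp
qed

text \<open>
  Only the three pairings of the four indices contribute, as in Wick's formula for Gaussian variables:
  in every other pattern some index occurs exactly once, and changing the sign of that coordinate shows
  that the moment is zero.
\<close>

lemma sphere_fourth_moment:
  assumes "i < n" "j < n" "k < n" "l < n"
  shows "(\<integral>x. x $ i * x $ j * x $ k * x $ l \<partial>U)
    = (of_bool (i = j \<and> k = l) + of_bool (i = k \<and> j = l) + of_bool (i = l \<and> j = k)) / (real n * (real n + 2))"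
proof -
  have "moment4 i j k l = moment4 j i k l" by (rule moment4_perm)
  moreover have "moment4 i j k l = moment4 k i j l"
    using moment4_perm(2)[of i j k l] moment4_perm(1)[of i k j l] by simp
  moreover have "moment4 i j k l = moment4 l i j k"
    using moment4_perm(3)[of i j k l] moment4_perm(2)[of i j l k] moment4_perm(1)[of i l j k] by simp
  ultimately have zi: "i \<notin> {j, k, l} \<Longrightarrow> moment4 i j k l = 0" and zj: "j \<notin> {i, k, l} \<Longrightarrow> moment4 i j k l = 0"
    and zk: "k \<notin> {i, j, l} \<Longrightarrow> moment4 i j k l = 0" and zl: "l \<notin> {i, j, k} \<Longrightarrow> moment4 i j k l = 0"
    using moment4_odd[OF assms] moment4_odd[OF assms(2,1,3,4)] moment4_odd[OF assms(3,1,2,4)]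
      moment4_odd[OF assms(4,1,2,3)] by simp_all
  have "moment4 i j k l = (of_bool (i = j \<and> k = l) + of_bool (i = k \<and> j = l) + of_bool (i = l \<and> j = k))
      / (real n * (real n + 2))"
  proof (cases "i = j")
    case True
    show ?thesis
    proof (cases "k = l")
      case True
      then show ?thesis using \<open>i = j\<close> moment4_value[OF assms(1,3)] by (cases "i = k") simp_all
    next
      case False
      then show ?thesis using \<open>i = j\<close> zk zl by (cases "k = i") simp_all
    qed
  next
    case ij: False
    show ?thesis
    proof (cases "i = k")
      case True
      then show ?thesis
        using ij zj moment4_value[OF assms(1,2)] moment4_perm(2)[of i j i j] by (cases "j = l") simp_all
    next
      case ik: False
      show ?thesis
      proof (cases "i = l")
        case True
        then show ?thesis
          using ij ik zj moment4_value[OF assms(1,2)] moment4_perm(2)[of i j i j] moment4_perm(3)[of i j j i]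
          by (cases "j = k") simp_all
      next
        case False
        then show ?thesis using ij ik zi by simp
      qed
    qed
  qed
  then show ?thesis unfolding moment4_def .
qed

end

section \<open>Quotients of Hankel forms\<close>

definition hankel :: "nat \<Rightarrow> (nat \<Rightarrow> real) \<Rightarrow> (nat \<Rightarrow> real) \<Rightarrow> real" where
  "hankel m \<mu> c = (\<Sum>i<m. \<Sum>j<m. c i * c j * \<mu> (i + j))"

lemma hankel_scale:
  assumes "\<And>i. i < m \<Longrightarrow> c i = s * d i"
  shows "hankel m \<mu> c = s\<^sup>2 * hankel m \<mu> d"
  unfolding hankel_def sum_distrib_left
  by (intro sum.cong refl) (simp add: assms power2_eq_square)

text \<open>
  The factor \<open>m\<close> comes from the Cauchy--Schwarz bound \<open>(\<Sum>\<^sub>i \<bar>c\<^sub>i\<bar>)\<^sup>2 \<le> m \<cdot> \<Sum>\<^sub>i c\<^sub>i\<^sup>2\<close>.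
\<close>

lemma hankel_perturb:
  assumes "\<And>k. k < 2 * m \<Longrightarrow> \<bar>\<nu> k - \<mu> k\<bar> \<le> \<delta>" "\<delta> \<ge> 0"
  shows "\<bar>hankel m \<nu> c - hankel m \<mu> c\<bar> \<le> \<delta> * real m * (\<Sum>i<m. (c i)\<^sup>2)"
proof -
  have "hankel m \<nu> c - hankel m \<mu> c = (\<Sum>i<m. \<Sum>j<m. c i * c j * (\<nu> (i + j) - \<mu> (i + j)))"
    unfolding hankel_def by (simp add: sum_subtractf right_diff_distrib)
  also have "\<bar>\<dots>\<bar> \<le> (\<Sum>i<m. \<Sum>j<m. \<bar>c i\<bar> * \<bar>c j\<bar> * \<delta>)"
  proof (intro order.trans[OF sum_abs] sum_mono)
    fix i j assume "i \<in> {..<m}" "j \<in> {..<m}"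
    then show "\<bar>c i * c j * (\<nu> (i + j) - \<mu> (i + j))\<bar> \<le> \<bar>c i\<bar> * \<bar>c j\<bar> * \<delta>"
      unfolding abs_mult by (intro mult_left_mono assms) auto
  qed
  also have "\<dots> = \<delta> * (\<Sum>i<m. \<bar>c i\<bar>)\<^sup>2"
    by (simp add: power2_eq_square sum_product sum_distrib_left mult_ac)
  also have "\<dots> \<le> \<delta> * (real m * (\<Sum>i<m. (c i)\<^sup>2))"
  proof (rule mult_left_mono[OF _ assms(2)])
    show "(\<Sum>i<m. \<bar>c i\<bar>)\<^sup>2 \<le> real m * (\<Sum>i<m. (c i)\<^sup>2)"
      using sum_squared_le_sum_of_squares[of "\<lambda>i. \<bar>c i\<bar>" "{..<m}"]
      by (simp only: power2_abs card_lessThan mult.commute)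
  qed
  finally show ?thesis by (simp add: mult.assoc)
qed

text \<open>
  Coefficient vectors are sequences supported below \<open>m\<close>, so that \<open>m\<close> can be a number and not a type;
  compactness then is Tychonoff's theorem for the product topology.
\<close>

lemma compact_coefficient_sphere:
  "compact {c :: nat \<Rightarrow> real. (\<forall>i\<ge>m. c i = 0) \<and> (\<Sum>i<m. (c i)\<^sup>2) = 1}" (is "compact ?S")
proof -
  have "compactin (product_topology (\<lambda>_ :: nat. euclidean :: real topology) UNIV)
      (PiE UNIV (\<lambda>_. {-1..1}))"
    by (simp add: compactin_PiE)
  then have "compact (PiE UNIV (\<lambda>_ :: nat. {-1..1 :: real}))"
    by (simp add: euclidean_product_topology)
  moreover have "closed ?S"
  proof -
    have "closed {c :: nat \<Rightarrow> real. m \<le> i \<longrightarrow> c i = 0}" for i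
      by (cases "m \<le> i") (auto intro!: closed_Collect_eq)
    then have "closed {c :: nat \<Rightarrow> real. \<forall>i. m \<le> i \<longrightarrow> c i = 0}"
      by (rule closed_Collect_all)
    moreover have "closed {c :: nat \<Rightarrow> real. (\<Sum>i<m. (c i)\<^sup>2) = 1}"
      by (intro closed_Collect_eq continuous_intros continuous_on_sum continuous_on_power) auto
    ultimately show ?thesis by (rule closed_Collect_conj)
  qed
  moreover have "?S \<subseteq> PiE UNIV (\<lambda>_. {-1..1})"
  proof
    fix c :: "nat \<Rightarrow> real" assume c: "c \<in> ?S"
    have "\<bar>c i\<bar> \<le> 1" for i
    proof (cases "i < m")
      case True
      then have "(c i)\<^sup>2 \<le> (\<Sum>i<m. (c i)\<^sup>2)" by (intro member_le_sum) auto
      with c have "(c i)\<^sup>2 \<le> 1" by simp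
      then show ?thesis by (simp add: abs_square_le_1)
    qed (use c in auto)
    then have "c i \<in> {-1..1}" for i by (metis abs_le_iff atLeastAtMost_iff minus_le_iff)
    then show "c \<in> PiE UNIV (\<lambda>_. {-1..1})" by (simp add: PiE_def Pi_def extensional_def)
  qed
  ultimately show ?thesis using compact_Int_closed[of "PiE UNIV (\<lambda>_ :: nat. {-1..1 :: real})" ?S] by (simp only: inf.absorb2)
qed

lemma continuous_on_hankel: "continuous_on S (hankel m \<mu>)"
  unfolding hankel_def
  by (rule continuous_on_subset[OF _ subset_UNIV]) (intro continuous_intros, auto)

text \<open>
  The quotient of the two forms is homogeneous of degree zero and continuous on the compact sphere of
  coefficient vectors, where the denominator is positive. Hence its supremum \<open>\<theta>\<close> is attained and the
  denominator has a positive lower bound \<open>\<kappa>\<close> there.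
\<close>

lemma hankel_extremal_ratio:
  assumes m: "m \<ge> 1" and pos: "\<And>c. \<exists>i<m. c i \<noteq> 0 \<Longrightarrow> hankel m \<mu> c > 0"
  obtains \<kappa> \<theta> d where "\<kappa> > 0" "\<And>c. \<kappa> * (\<Sum>i<m. (c i)\<^sup>2) \<le> hankel m \<mu> c"
    "\<And>c. hankel m \<nu> c \<le> \<theta> * hankel m \<mu> c"
    "\<exists>i<m. d i \<noteq> 0" "hankel m \<nu> d = \<theta> * hankel m \<mu> d"
proof -
  define S where "S = {c :: nat \<Rightarrow> real. (\<forall>i\<ge>m. c i = 0) \<and> (\<Sum>i<m. (c i)\<^sup>2) = 1}"
  have S: "compact S" unfolding S_def by (rule compact_coefficient_sphere)
  have "(\<Sum>i<m. (if i = 0 then 1 else 0 :: real)\<^sup>2) = (\<Sum>i<m. if i = 0 then 1 else 0)"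
    by (intro sum.cong) auto
  also have "\<dots> = 1" using m by simp
  finally have "(\<lambda>i. if i = 0 then 1 else 0) \<in> S"
    using m by (simp add: S_def)
  then have ne: "S \<noteq> {}" by auto
  have nz: "\<exists>i<m. c i \<noteq> 0" if "c \<in> S" for c
  proof (rule ccontr)
    assume "\<not> (\<exists>i<m. c i \<noteq> 0)"
    then have "(\<Sum>i<m. (c i)\<^sup>2) = 0" by simp
    with that show False by (simp add: S_def)
  qed
  have posS: "hankel m \<mu> c > 0" if "c \<in> S" for c using pos nz[OF that] by blast
  have "continuous_on S (\<lambda>c. hankel m \<nu> c / hankel m \<mu> c)"
    using posS by (intro continuous_on_divide continuous_on_hankel) force
  from continuous_attains_sup[OF S ne this] obtain d where
    d: "d \<in> S" "\<And>c. c \<in> S \<Longrightarrow> hankel m \<nu> c / hankel m \<mu> c \<le> hankel m \<nu> d / hankel m \<mu> d" by blast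
  from continuous_attains_inf[OF S ne continuous_on_hankel] obtain e where
    e: "e \<in> S" "\<And>c. c \<in> S \<Longrightarrow> hankel m \<mu> e \<le> hankel m \<mu> c" by blast
  define \<kappa> where "\<kappa> = hankel m \<mu> e"
  define \<theta> where "\<theta> = hankel m \<nu> d / hankel m \<mu> d"
  have normalise: "\<exists>s c'. s\<^sup>2 = (\<Sum>i<m. (c i)\<^sup>2) \<and> c' \<in> S \<and> (\<forall>i<m. c i = s * c' i)"
    for c :: "nat \<Rightarrow> real"
  proof (cases "(\<Sum>i<m. (c i)\<^sup>2) = 0")
    case True
    then have "\<forall>i<m. c i = 0" by (subst (asm) sum_nonneg_eq_0_iff) auto
    then show ?thesis using True d(1) by (intro exI[of _ 0] exI[of _ d]) auto
  next
    case False
    define s where "s = sqrt (\<Sum>i<m. (c i)\<^sup>2)"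
    have nn: "(\<Sum>i<m. (c i)\<^sup>2) \<ge> 0" by (intro sum_nonneg) auto
    then have s: "s\<^sup>2 = (\<Sum>i<m. (c i)\<^sup>2)" "s \<noteq> 0" using False by (auto simp: s_def)
    define c' where "c' = (\<lambda>i. if i < m then c i / s else 0)"
    have "(\<Sum>i<m. (c' i)\<^sup>2) = (\<Sum>i<m. (c i)\<^sup>2) / s\<^sup>2"
      by (simp add: c'_def power_divide sum_divide_distrib)
    then have "(\<Sum>i<m. (c' i)\<^sup>2) = 1" using s False by simp
    then have "c' \<in> S" by (auto simp: S_def c'_def)
    moreover have "\<forall>i<m. c i = s * c' i" using s by (simp add: c'_def)
    ultimately show ?thesis using s by blast
  qed
  show thesis
  proof (rule that)
    show "\<kappa> > 0" unfolding \<kappa>_def using posS e by blast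
    show "\<exists>i<m. d i \<noteq> 0" using nz d by blast
    show "hankel m \<nu> d = \<theta> * hankel m \<mu> d" using posS[OF d(1)] by (simp add: \<theta>_def)
    fix c
    obtain s c' where c': "s\<^sup>2 = (\<Sum>i<m. (c i)\<^sup>2)" "c' \<in> S" "\<And>i. i < m \<Longrightarrow> c i = s * c' i"
      using normalise[of c] by blast
    have h: "hankel m \<rho> c = s\<^sup>2 * hankel m \<rho> c'" for \<rho> using hankel_scale c'(3) by blast
    have "s\<^sup>2 * \<kappa> \<le> s\<^sup>2 * hankel m \<mu> c'" using e(2)[OF c'(2)] by (intro mult_left_mono) (auto simp: \<kappa>_def)
    then show "\<kappa> * (\<Sum>i<m. (c i)\<^sup>2) \<le> hankel m \<mu> c" unfolding h c'(1)[symmetric] by (simp add: mult.commute)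
    have "hankel m \<nu> c' \<le> \<theta> * hankel m \<mu> c'"
      using d(2)[OF c'(2)] posS[OF c'(2)] by (simp add: \<theta>_def pos_divide_le_eq)
    then have "s\<^sup>2 * hankel m \<nu> c' \<le> s\<^sup>2 * (\<theta> * hankel m \<mu> c')" by (intro mult_left_mono) auto
    then show "hankel m \<nu> c \<le> \<theta> * hankel m \<mu> c" unfolding h by (simp add: mult_ac)
  qed
qed

text \<open>
  Moving the moments by \<open>\<delta>\<close> moves both forms by at most \<open>N \<cdot> \<Sum>\<^sub>i c\<^sub>i\<^sup>2\<close> with \<open>N = \<delta> m\<close>, and this is
  absorbed by the denominator, which stays above \<open>\<kappa>/2 \<cdot> \<Sum>\<^sub>i c\<^sub>i\<^sup>2\<close>. The upper bound on the new supremum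
  is uniform in \<open>c\<close>; for the lower bound it suffices to look at the old maximiser \<open>d\<close>.
\<close>

lemma hankel_ratio_stable:
  assumes \<kappa>: "\<kappa> > 0" "\<And>c. \<kappa> * (\<Sum>i<m. (c i)\<^sup>2) \<le> hankel m \<mu> c"
    and \<theta>: "\<And>c. hankel m (\<lambda>k. \<mu> (Suc k)) c \<le> \<theta> * hankel m \<mu> c"
    and d: "\<exists>i<m. d i \<noteq> 0" "hankel m (\<lambda>k. \<mu> (Suc k)) d = \<theta> * hankel m \<mu> d"
    and \<eta>: "\<eta> > 0"
  shows "\<exists>\<delta>>0. \<forall>\<nu>. (\<forall>k\<le>2 * m. \<bar>\<nu> k - \<mu> k\<bar> \<le> \<delta>) \<longrightarrow>
    (\<forall>c. (\<exists>i<m. c i \<noteq> 0) \<longrightarrow> hankel m \<nu> c > 0) \<and>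
    \<bar>(SUP c \<in> {c. \<exists>i<m. c i \<noteq> 0}. hankel m (\<lambda>k. \<nu> (Suc k)) c / hankel m \<nu> c) - \<theta>\<bar> \<le> \<eta>"
proof -
  \<comment> \<open>Small enough to keep half of \<open>\<kappa>\<close>, and to make the error \<open>(\<bar>\<theta>\<bar> + 1) N\<close> at most \<open>\<eta>\<close> times that half.\<close>
  define N where "N = min (\<kappa> / 2) (\<eta> * \<kappa> / (2 * (\<bar>\<theta>\<bar> + 1)))"
  have N: "N > 0" "N \<le> \<kappa> / 2"
    using \<kappa>(1) \<eta> by (auto simp only: N_def min.cobounded1) auto
  have "N \<le> \<eta> * \<kappa> / (2 * (\<bar>\<theta>\<bar> + 1))" unfolding N_def by (rule min.cobounded2)
  moreover have "0 < 2 * (\<bar>\<theta>\<bar> + 1)" by simp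
  ultimately have "N * (2 * (\<bar>\<theta>\<bar> + 1)) \<le> \<eta> * \<kappa>"
    using pos_le_divide_eq by blast
  then have N3: "(\<bar>\<theta>\<bar> + 1) * N \<le> \<eta> * (\<kappa> / 2)" by (simp add: algebra_simps)
  have m: "real m > 0" using d by auto
  define \<delta> where "\<delta> = N / real m"
  have \<delta>: "\<delta> > 0" "\<delta> * real m = N" using N m by (auto simp: \<delta>_def)
  define Q where "Q c = (\<Sum>i<m. (c i)\<^sup>2)" for c :: "nat \<Rightarrow> real"
  have Qpos: "Q c > 0" if c: "\<exists>i<m. c i \<noteq> 0" for c
  proof -
    obtain i where "i < m" "c i \<noteq> 0" using c by blast
    moreover have "(c i)\<^sup>2 \<le> Q c" unfolding Q_def using \<open>i < m\<close> by (intro member_le_sum) auto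
    ultimately show ?thesis by (smt (verit) zero_less_power2)
  qed
  show ?thesis
  proof (intro exI[of _ \<delta>] conjI allI impI \<delta>(1))
    fix \<nu> :: "nat \<Rightarrow> real" assume \<nu>: "\<forall>k\<le>2 * m. \<bar>\<nu> k - \<mu> k\<bar> \<le> \<delta>"
    let ?F = "hankel m \<mu>" and ?F' = "hankel m \<nu>"
    let ?G = "hankel m (\<lambda>k. \<mu> (Suc k))" and ?G' = "hankel m (\<lambda>k. \<nu> (Suc k))"
    have FF: "\<bar>?F' c - ?F c\<bar> \<le> N * Q c" for c
      unfolding Q_def \<delta>(2)[symmetric] using \<nu> \<delta> by (intro hankel_perturb) auto
    have GG: "\<bar>?G' c - ?G c\<bar> \<le> N * Q c" for c
      unfolding Q_def \<delta>(2)[symmetric] using \<nu> \<delta> by (intro hankel_perturb) auto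
    have low: "(\<kappa> / 2) * Q c \<le> ?F' c" for c
    proof -
      have "0 \<le> Q c" by (simp add: Q_def sum_nonneg)
      then have "N * Q c \<le> (\<kappa> / 2) * Q c" using N by (intro mult_right_mono)
      then show ?thesis using FF[of c] \<kappa>(2)[of c] by (simp add: Q_def[symmetric] abs_le_iff)
    qed
    have pos: "?F' c > 0" if "\<exists>i<m. c i \<noteq> 0" for c
      using low[of c] Qpos[OF that] \<kappa>(1) by (smt (verit) half_gt_zero mult_pos_pos)
    then show "?F' c > 0" if "\<exists>i<m. c i \<noteq> 0" for c using that .
    have err: "(\<bar>\<theta>\<bar> + 1) * (N * Q c) \<le> \<eta> * ?F' c" for c
    proof -
      have "0 \<le> Q c" by (simp add: Q_def sum_nonneg)
      then have "(\<bar>\<theta>\<bar> + 1) * N * Q c \<le> \<eta> * (\<kappa> / 2) * Q c" using N3 by (intro mult_right_mono)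
      also have "\<dots> \<le> \<eta> * ?F' c" using low[of c] \<eta> by (simp add: mult.assoc)
      finally show ?thesis by (simp add: mult.assoc)
    qed
    have dev: "\<bar>\<theta> * ?F' c - \<theta> * ?F c\<bar> \<le> \<bar>\<theta>\<bar> * (N * Q c)" for c
      using FF[of c] by (simp add: abs_mult mult_left_mono flip: right_diff_distrib)
    have up: "?G' c \<le> (\<theta> + \<eta>) * ?F' c" for c
      using GG[of c] dev[of c] \<theta>[of c] err[of c] by (simp add: distrib_right abs_le_iff)
    have lo: "(\<theta> - \<eta>) * ?F' d \<le> ?G' d"
      using GG[of d] dev[of d] d(2) err[of d] by (simp add: distrib_right left_diff_distrib abs_le_iff)
    let ?C = "{c. \<exists>i<m. c i \<noteq> (0 :: real)}"
    have ub: "?G' c / ?F' c \<le> \<theta> + \<eta>" if "c \<in> ?C" for c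
      using up[of c] pos[of c] that by (simp add: pos_divide_le_eq)
    have "(SUP c \<in> ?C. ?G' c / ?F' c) \<le> \<theta> + \<eta>"
      using d(1) ub by (intro cSUP_least) blast+
    moreover have "\<theta> - \<eta> \<le> ?G' d / ?F' d" using lo pos[OF d(1)] by (simp add: pos_le_divide_eq)
    moreover have "?G' d / ?F' d \<le> (SUP c \<in> ?C. ?G' c / ?F' c)"
      using d(1) ub by (intro cSUP_upper bdd_aboveI2) blast+
    ultimately show "\<bar>(SUP c \<in> ?C. ?G' c / ?F' c) - \<theta>\<bar> \<le> \<eta>" by (simp add: abs_le_iff)
  qed
qed

section \<open>The largest zero of an orthogonal polynomial as an extremal quotient\<close>

definition weighted_integral :: "real \<Rightarrow> real \<Rightarrow> (real \<Rightarrow> real) \<Rightarrow> real poly \<Rightarrow> real" where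
  "weighted_integral a b \<sigma> p = integral {a..b} (\<lambda>x. poly p x * \<sigma> x)"

definition moment :: "real \<Rightarrow> real \<Rightarrow> (real \<Rightarrow> real) \<Rightarrow> nat \<Rightarrow> real" where
  "moment a b \<sigma> k = integral {a..b} (\<lambda>x. x ^ k * \<sigma> x)"

definition coeff_poly :: "nat \<Rightarrow> (nat \<Rightarrow> real) \<Rightarrow> real poly" where
  "coeff_poly m c = (\<Sum>i<m. Polynomial.monom (c i) i)"

lemma nonpos_quadratic_linear_term_zero:
  fixes B C :: real
  assumes "\<And>t. 2 * t * B + t\<^sup>2 * C \<le> 0"
  shows "B = 0"
proof (rule ccontr)
  assume "B \<noteq> 0"
  define D where "D = \<bar>C\<bar> + 1"
  have D: "D > 0" "\<bar>C\<bar> < D" by (auto simp: D_def)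
  \<comment> \<open>For small \<open>t\<close> of the sign of \<open>B\<close> the linear term dominates; \<open>t = B / D\<close> is small enough.\<close>
  have "2 * (B / D) * B + (B / D)\<^sup>2 * C \<le> 0" by (rule assms)
  then have "2 * B\<^sup>2 * D + B\<^sup>2 * C \<le> 0"
    using D(1) by (simp add: field_simps power2_eq_square)
  then have "B\<^sup>2 * (2 * D + C) \<le> 0" by (simp add: algebra_simps)
  moreover have "2 * D + C > 0" using D by linarith
  ultimately show False using \<open>B \<noteq> 0\<close> by (simp add: mult_le_0_iff)
qed

context
  fixes a b :: real and \<sigma> :: "real \<Rightarrow> real"
  assumes ab: "a < b" and cont: "continuous_on {a..b} \<sigma>"
    and nonneg: "\<And>x. x \<in> {a..b} \<Longrightarrow> \<sigma> x \<ge> 0"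
    and mass: "integral {a..b} \<sigma> = 1"
begin

abbreviation "wint \<equiv> weighted_integral a b \<sigma>"
abbreviation "mom \<equiv> moment a b \<sigma>"

lemma weighted_continuous: "continuous_on {a..b} (\<lambda>x. poly p x * \<sigma> x)"
  by (intro continuous_intros cont)

lemma weighted_integrable: "(\<lambda>x. poly p x * \<sigma> x) integrable_on {a..b}"
  by (intro integrable_continuous_real weighted_continuous)

lemma wint_add: "wint (p + q) = wint p + wint q"
  unfolding weighted_integral_def poly_add distrib_right
  by (intro integral_add weighted_integrable)

lemma wint_smult: "wint (Polynomial.smult c p) = c * wint p"
  unfolding weighted_integral_def poly_smult mult.assoc by (rule integral_mult_right)

lemma wint_0: "wint 0 = 0"
  by (simp add: weighted_integral_def)

lemma wint_sum: "wint (\<Sum>i\<in>A. f i) = (\<Sum>i\<in>A. wint (f i))"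
  by (induction A rule: infinite_finite_induct) (auto simp: wint_add wint_0)

text \<open>
  If the integral vanished, continuity would make \<open>\<sigma>\<close> vanish off the finitely many roots of \<open>p\<close>,
  contradicting that it has mass one.
\<close>

lemma wint_square_pos:
  assumes "p \<noteq> 0"
  shows "wint (p * p) > 0"
proof -
  have nn: "poly (p * p) x * \<sigma> x \<ge> 0" if "x \<in> {a..b}" for x
    using nonneg[OF that] by simp
  have "wint (p * p) \<ge> 0"
    unfolding weighted_integral_def using nn by (intro integral_nonneg weighted_integrable)
  moreover have "wint (p * p) \<noteq> 0"
  proof
    assume "wint (p * p) = 0"
    then have z: "\<forall>x\<in>{a..b}. poly (p * p) x * \<sigma> x = 0"
      using integral_eq_0_iff[OF weighted_continuous ab nn] unfolding weighted_integral_def by blast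
    have "integral {a..b} \<sigma> = integral {a..b} (\<lambda>_. 0)"
    proof (rule integral_spike)
      show "negligible {x. poly p x = 0}"
        using assms by (intro negligible_finite poly_roots_finite)
      show "0 = \<sigma> x" if "x \<in> {a..b} - {x. poly p x = 0}" for x
        using z that by auto
    qed
    with mass show False by simp
  qed
  ultimately show ?thesis by simp
qed

lemma wint_monom: "wint (Polynomial.monom c k) = c * mom k"
proof -
  have "wint (Polynomial.monom c k) = integral {a..b} (\<lambda>x. c * (x ^ k * \<sigma> x))"
    by (simp add: weighted_integral_def poly_monom mult.assoc)
  then show ?thesis by (simp add: moment_def)
qed

text \<open>
  With \<open>l = 0\<close> this is the denominator of the quotient, with \<open>l = 1\<close> its numerator.
\<close>

lemma wint_coeff_poly_square:
  "wint (Polynomial.monom 1 l * (coeff_poly m c * coeff_poly m c)) = hankel m (\<lambda>k. mom (k + l)) c"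
proof -
  have "coeff_poly m c * coeff_poly m c = (\<Sum>i<m. \<Sum>j<m. Polynomial.monom (c i * c j) (i + j))"
    unfolding coeff_poly_def sum_product by (simp add: mult_monom)
  then have "Polynomial.monom 1 l * (coeff_poly m c * coeff_poly m c)
    = (\<Sum>i<m. \<Sum>j<m. Polynomial.monom (c i * c j) (i + j + l))"
    by (simp add: sum_distrib_left mult_monom add.commute)
  then show ?thesis by (simp add: wint_sum wint_monom hankel_def)
qed

lemma coeff_poly_coeff:
  assumes "degree p < m"
  shows "coeff_poly m (Polynomial.coeff p) = p"
proof (rule poly_eqI)
  fix k
  show "Polynomial.coeff (coeff_poly m (Polynomial.coeff p)) k = Polynomial.coeff p k"
    using assms by (auto simp: coeff_poly_def Polynomial.coeff_sum coeff_eq_0)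
qed

lemma coeff_coeff_poly: "Polynomial.coeff (coeff_poly m c) k = (if k < m then c k else 0)"
  by (auto simp: coeff_poly_def Polynomial.coeff_sum)

lemma degree_coeff_poly: "m \<ge> 1 \<Longrightarrow> degree (coeff_poly m c) < m"
  unfolding coeff_poly_def
  by (intro degree_sum_less) (auto intro: le_less_trans[OF degree_monom_le])

lemma hankel_moment_pos:
  assumes "\<exists>i<m. c i \<noteq> 0"
  shows "hankel m mom c > 0"
proof -
  have "coeff_poly m c \<noteq> 0"
    using assms coeff_coeff_poly by (metis Polynomial.coeff_0)
  then show ?thesis
    using wint_square_pos[of "coeff_poly m c"] wint_coeff_poly_square[of 0 m c] by simp
qed

text \<open>
  Let \<open>q\<close> be the polynomial with the maximising coefficients \<open>d\<close>, and \<open>P = (x - \<theta>) q\<close>. The functional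
  \<open>p \<mapsto> \<integral> (x - \<theta>) p\<^sup>2 \<sigma>\<close> is nonpositive on degree below \<open>m\<close> and zero at \<open>q\<close>, so its first variation
  at \<open>q\<close> vanishes, which says that \<open>P\<close> is orthogonal to all \<open>h\<close> of degree below \<open>m\<close>. As \<open>P\<close> is not
  orthogonal to itself it has degree \<open>m\<close>, and up to scaling it is the orthogonal polynomial. This
  argument also provides existence and uniqueness of that polynomial, and shows that it has a real
  zero.
\<close>

lemma largest_zero_orth_poly:
  assumes m: "m \<ge> 1"
    and \<theta>: "\<And>c. hankel m (\<lambda>k. mom (Suc k)) c \<le> \<theta> * hankel m mom c"
    and d: "\<exists>i<m. d i \<noteq> 0" "hankel m (\<lambda>k. mom (Suc k)) d = \<theta> * hankel m mom d"
  shows "largest_zero (orth_poly a b \<sigma> m) = \<theta>"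
proof -
  define q where "q = coeff_poly m d"
  have q: "q \<noteq> 0" "degree q < m"
    using d(1) coeff_coeff_poly degree_coeff_poly[OF m] unfolding q_def by (metis Polynomial.coeff_0, blast)
  have X: "[:- \<theta>, 1:] = Polynomial.monom 1 1 + Polynomial.smult (- \<theta>) (Polynomial.monom 1 0)"
    by (simp add: monom_altdef)
  have lin: "wint ([:- \<theta>, 1:] * (coeff_poly m c * coeff_poly m c))
    = hankel m (\<lambda>k. mom (Suc k)) c - \<theta> * hankel m mom c" for c
    unfolding X distrib_right Polynomial.mult_smult_left wint_add wint_smult wint_coeff_poly_square by simp
  have le: "wint ([:- \<theta>, 1:] * (p * p)) \<le> 0" if "degree p < m" for p
    using lin[of "Polynomial.coeff p"] \<theta>[of "Polynomial.coeff p"] by (simp only: coeff_poly_coeff[OF that])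
  have eq: "wint ([:- \<theta>, 1:] * (q * q)) = 0" using lin[of d] d(2) by (simp add: q_def)
  define P where "P = [:- \<theta>, 1:] * q"
  have orth: "wint (P * h) = 0" if h: "degree h < m" for h
  proof (rule nonpos_quadratic_linear_term_zero)
    fix t :: real
    define g where "g = q + Polynomial.smult t h"
    have "degree g < m" unfolding g_def
      using q h by (intro degree_add_less le_less_trans[OF degree_smult_le])
    then have "wint ([:- \<theta>, 1:] * (g * g)) \<le> 0" by (rule le)
    moreover have "[:- \<theta>, 1:] * (g * g) = [:- \<theta>, 1:] * (q * q) + Polynomial.smult (2 * t) (P * h)
        + Polynomial.smult (t\<^sup>2) ([:- \<theta>, 1:] * (h * h))"
      unfolding g_def P_def by (rule poly_ext) (simp add: algebra_simps power2_eq_square)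
    ultimately show "2 * t * wint (P * h) + t\<^sup>2 * wint ([:- \<theta>, 1:] * (h * h)) \<le> 0"
      by (simp only: wint_add wint_smult eq)
  qed
  have P0: "P \<noteq> 0" using q by (simp add: P_def del: mult_pCons_left)
  have "degree P = 1 + degree q" unfolding P_def using q by (subst degree_mult_eq) auto
  then have degP: "degree P = m"
    using orth[of P] wint_square_pos[OF P0] q by (cases "degree P < m") auto
  define p where "p = Polynomial.smult (1 / lead_coeff P) P"
  have lc: "lead_coeff P \<noteq> 0" using P0 by simp
  have p: "degree p = m" "lead_coeff p = 1"
    using degP lc by (simp_all add: p_def)
  have orthp: "wint (p * h) = 0" if "degree h < m" for h
    using orth[OF that] by (simp add: p_def wint_smult)
  have wint_eq: "wint (r * h) = integral {a..b} (\<lambda>x. poly r x * poly h x * \<sigma> x)" for r h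
    by (simp add: weighted_integral_def)
  have op: "orth_poly a b \<sigma> m = p"
    unfolding orth_poly_def
  proof (rule the_equality)
    show "degree p = m \<and> lead_coeff p = 1 \<and>
      (\<forall>q. degree q < m \<longrightarrow> integral {a..b} (\<lambda>x. poly p x * poly q x * \<sigma> x) = 0)"
      using p orthp wint_eq by auto
  next
    fix r assume r: "degree r = m \<and> lead_coeff r = 1 \<and>
      (\<forall>q. degree q < m \<longrightarrow> integral {a..b} (\<lambda>x. poly r x * poly q x * \<sigma> x) = 0)"
    have dlt: "degree (r - p) < m"
    proof (rule degree_lessI)
      show "r - p \<noteq> 0 \<or> m > 0" using m by simp
      show "\<forall>k\<ge>m. Polynomial.coeff (r - p) k = 0"
      proof (intro allI impI)
        fix k assume "m \<le> k"
        then show "Polynomial.coeff (r - p) k = 0"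
          using r p by (cases "k = m") (auto simp: coeff_eq_0)
      qed
    qed
    have "(r - p) * (r - p) = r * (r - p) + Polynomial.smult (-1) (p * (r - p))"
      by (simp add: left_diff_distrib)
    then have "wint ((r - p) * (r - p)) = wint (r * (r - p)) + (-1) * wint (p * (r - p))"
      by (simp only: wint_add wint_smult)
    also have "\<dots> = 0"
    proof -
      have "wint (r * (r - p)) = 0" using r dlt unfolding wint_eq by blast
      then show ?thesis using orthp[OF dlt] by simp
    qed
    finally show "r = p" using wint_square_pos[of "r - p"] by auto
  qed
  have zeros: "{x. poly p x = 0} = {x. poly P x = 0}" using lc by (simp add: p_def)
  have "Max {x. poly P x = 0} = \<theta>"
  proof (rule Max_eqI)
    show "finite {x. poly P x = 0}" using P0 by (rule poly_roots_finite)
    show "\<theta> \<in> {x. poly P x = 0}" by (simp add: P_def)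
    fix \<xi> assume "\<xi> \<in> {x. poly P x = 0}"
    then obtain r where r: "P = [:- \<xi>, 1:] * r" by (auto simp: poly_eq_0_iff_dvd dvd_def)
    have r0: "r \<noteq> 0" using r P0 by auto
    have "degree P = 1 + degree r" unfolding r using r0 by (subst degree_mult_eq) auto
    then have dr: "degree r < m" using degP by simp
    \<comment> \<open>The quotient takes the value \<open>\<xi>\<close> at \<open>r\<close>, because \<open>P\<close> is orthogonal to \<open>r\<close>.\<close>
    have "[:- \<theta>, 1:] * (r * r) = P * r + Polynomial.smult (\<xi> - \<theta>) (r * r)"
      unfolding r by (rule poly_ext) (simp add: algebra_simps)
    then have "wint ([:- \<theta>, 1:] * (r * r)) = (\<xi> - \<theta>) * wint (r * r)"
      by (simp only: wint_add wint_smult orth[OF dr])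
    with le[OF dr] have "(\<xi> - \<theta>) * wint (r * r) \<le> 0" by simp
    then show "\<xi> \<le> \<theta>" using wint_square_pos[OF r0] by (simp add: mult_le_0_iff)
  qed
  then show ?thesis unfolding largest_zero_def op zeros .
qed

end

section \<open>Ritz values as extremal quotients of Hankel forms\<close>

definition krylov_vec :: "nat \<Rightarrow> real mat \<Rightarrow> real vec \<Rightarrow> (nat \<Rightarrow> real) \<Rightarrow> real vec" where
  "krylov_vec m A v c = vec (dim_vec v) (\<lambda>i. \<Sum>k<m. c k * ((A ^\<^sub>m k) *\<^sub>v v) $ i)"

text \<open>
  The generators need not be distinct, so the span is described by lists of vectors, where every
  \<open>X\<^sup>k v\<close> has its own coefficient.
\<close>

lemma krylov_eq_range:
  assumes A: "A \<in> carrier_mat n n" and v: "v \<in> carrier_vec n"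
  shows "krylov m A v = range (krylov_vec m A v)"
proof -
  interpret W: vec_space "TYPE(real)" n .
  define ws where "ws = map (\<lambda>k. (A ^\<^sub>m k) *\<^sub>v v) [0..<m]"
  have wk: "(A ^\<^sub>m k) *\<^sub>v v \<in> carrier_vec n" for k
    using mult_mat_vec_carrier[OF pow_carrier_mat[OF A] v] .
  have ws: "set ws \<subseteq> carrier_vec n" using wk by (auto simp: ws_def)
  have dv: "dim_vec v = n" using v by simp
  have comb: "W.lincomb_list c ws = krylov_vec m A v c" for c
  proof (rule eq_vecI)
    have len: "length ws = m" by (simp add: ws_def)
    have dims: "\<forall>x\<in>set (map (\<lambda>i. c i \<cdot>\<^sub>v ws ! i) [0..<length ws]). dim_vec x = n"
      using wk A by (auto simp: ws_def)
    then show "dim_vec (W.lincomb_list c ws) = dim_vec (krylov_vec m A v c)"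
      unfolding W.lincomb_list_def by (simp add: W.dim_sumlist krylov_vec_def dv)
    fix i assume "i < dim_vec (krylov_vec m A v c)"
    then have i: "i < n" by (simp add: krylov_vec_def dv)
    show "W.lincomb_list c ws $ i = krylov_vec m A v c $ i"
      unfolding W.lincomb_list_def W.sumlist_nth[OF dims i]
      using i A by (simp add: krylov_vec_def dv len atLeast0LessThan)
        (simp add: ws_def)
  qed
  have "krylov m A v = W.span (set ws)"
    unfolding krylov_def dv by (simp add: ws_def atLeast0LessThan)
  also have "\<dots> = W.span_list ws" by (rule W.span_list_as_span[OF ws, symmetric])
  also have "\<dots> = range (krylov_vec m A v)"
    unfolding W.span_list_def comb by auto
  finally show ?thesis .
qed

lemma scalar_prod_sum:
  "y \<in> carrier_vec n \<Longrightarrow> x \<bullet> y = (\<Sum>i<n. x $ i * y $ i)"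
  by (simp add: scalar_prod_def atLeast0LessThan)

lemma krylov_vec_scalar_prod:
  assumes A: "A \<in> carrier_mat n n" and v: "v \<in> carrier_vec n" and y: "y \<in> carrier_vec n"
  shows "krylov_vec m A v c \<bullet> y = (\<Sum>k<m. c k * (((A ^\<^sub>m k) *\<^sub>v v) \<bullet> y))"
proof -
  have "krylov_vec m A v c \<bullet> y = (\<Sum>i<n. \<Sum>k<m. c k * ((A ^\<^sub>m k) *\<^sub>v v) $ i * y $ i)"
    using v by (simp add: scalar_prod_sum[OF y] krylov_vec_def sum_distrib_right)
  also have "\<dots> = (\<Sum>k<m. \<Sum>i<n. c k * ((A ^\<^sub>m k) *\<^sub>v v) $ i * y $ i)"
    by (rule sum.swap)
  also have "\<dots> = (\<Sum>k<m. c k * (((A ^\<^sub>m k) *\<^sub>v v) \<bullet> y))"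
    by (simp only: scalar_prod_sum[OF y] sum_distrib_left mult.assoc)
  finally show ?thesis .
qed

lemma symmetric_scalar_prod_swap:
  fixes x y :: "real vec"
  assumes A: "A \<in> symmetric_mats n" and x: "x \<in> carrier_vec n" and y: "y \<in> carrier_vec n"
  shows "(A *\<^sub>v y) \<bullet> x = y \<bullet> (A *\<^sub>v x)"
  using transpose_vec_mult_scalar[of A n n x y] assms by (simp add: symmetric_mats_def)

lemma krylov_power_scalar_prod:
  assumes A: "A \<in> symmetric_mats n" and v: "v \<in> carrier_vec n"
  shows "((A ^\<^sub>m i) *\<^sub>v v) \<bullet> ((A ^\<^sub>m j) *\<^sub>v v) = v \<bullet> ((A ^\<^sub>m (i + j)) *\<^sub>v v)"
proof -
  have Ac: "A \<in> carrier_mat n n" using A by (rule symmetric_mats_carrier)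
  have p: "A ^\<^sub>m i \<in> carrier_mat n n" "A ^\<^sub>m j \<in> carrier_mat n n" using Ac by simp_all
  have "((A ^\<^sub>m i) *\<^sub>v v) \<bullet> ((A ^\<^sub>m j) *\<^sub>v v) = v \<bullet> ((A ^\<^sub>m i) *\<^sub>v ((A ^\<^sub>m j) *\<^sub>v v))"
    by (rule symmetric_scalar_prod_swap[OF pow_mat_symmetric[OF A] mult_mat_vec_carrier[OF p(2) v] v])
  also have "(A ^\<^sub>m i) *\<^sub>v ((A ^\<^sub>m j) *\<^sub>v v) = (A ^\<^sub>m i * A ^\<^sub>m j) *\<^sub>v v"
    by (rule assoc_mult_mat_vec[OF p v, symmetric])
  finally show ?thesis by (simp only: pow_mat_add[OF Ac])
qed

text \<open>
  By symmetry \<open>(A\<^sup>i v) \<bullet> (A\<^sup>j v) = v \<bullet> (A\<^sup>i\<^sup>+\<^sup>j v)\<close>, which is what makes the Gram matrix a Hankel matrix.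
\<close>

lemma krylov_vec_quadratic:
  fixes m :: nat
  assumes A: "A \<in> symmetric_mats n" and v: "v \<in> carrier_vec n"
  defines "x c \<equiv> krylov_vec m A v c" and "\<nu> k \<equiv> v \<bullet> ((A ^\<^sub>m k) *\<^sub>v v)"
  shows "x c \<bullet> x c = hankel m \<nu> c" and "x c \<bullet> (A *\<^sub>v x c) = hankel m (\<lambda>k. \<nu> (Suc k)) c"
proof -
  have Ac: "A \<in> carrier_mat n n" using A by (rule symmetric_mats_carrier)
  have xc: "x c \<in> carrier_vec n" using v by (simp add: x_def krylov_vec_def)
  let ?w = "\<lambda>k. (A ^\<^sub>m k) *\<^sub>v v"
  have w: "?w k \<in> carrier_vec n" for k
    using mult_mat_vec_carrier[OF pow_carrier_mat[OF Ac] v] .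
  have Aw: "A *\<^sub>v ?w k = ?w (Suc k)" for k
  proof -
    have "A *\<^sub>v ?w k = (A ^\<^sub>m 1 * A ^\<^sub>m k) *\<^sub>v v"
      using assoc_mult_mat_vec[OF Ac pow_carrier_mat[OF Ac] v] Ac by simp
    then show ?thesis using pow_mat_add[OF Ac, of 1 k] by simp
  qed
  have comm: "y \<bullet> z = z \<bullet> y" if "y \<in> carrier_vec n" "z \<in> carrier_vec n" for y z :: "real vec"
    using that by (rule comm_scalar_prod)
  have "x c \<bullet> x c = (\<Sum>i<m. c i * (?w i \<bullet> x c))"
    unfolding x_def by (rule krylov_vec_scalar_prod[OF Ac v xc[unfolded x_def]])
  also have "\<dots> = (\<Sum>i<m. c i * (\<Sum>j<m. c j * \<nu> (i + j)))"
  proof (intro sum.cong refl arg_cong2[where f = "(*)"])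
    fix i
    have "?w i \<bullet> x c = x c \<bullet> ?w i" using w xc by (rule comm)
    also have "\<dots> = (\<Sum>j<m. c j * (?w j \<bullet> ?w i))"
      unfolding x_def by (rule krylov_vec_scalar_prod[OF Ac v w])
    finally show "?w i \<bullet> x c = (\<Sum>j<m. c j * \<nu> (i + j))"
      by (simp only: krylov_power_scalar_prod[OF A v] \<nu>_def add.commute)
  qed
  also have "\<dots> = hankel m \<nu> c" by (simp add: hankel_def sum_distrib_left mult.assoc)
  finally show "x c \<bullet> x c = hankel m \<nu> c" .
  have Ax: "A *\<^sub>v x c \<in> carrier_vec n" using mult_mat_vec_carrier[OF Ac xc] .
  have "x c \<bullet> (A *\<^sub>v x c) = (\<Sum>i<m. c i * (?w i \<bullet> (A *\<^sub>v x c)))"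
    unfolding x_def by (rule krylov_vec_scalar_prod[OF Ac v Ax[unfolded x_def]])
  also have "\<dots> = (\<Sum>i<m. c i * (\<Sum>j<m. c j * \<nu> (Suc (i + j))))"
  proof (intro sum.cong refl arg_cong2[where f = "(*)"])
    fix i
    have "?w i \<bullet> (A *\<^sub>v x c) = (A *\<^sub>v ?w i) \<bullet> x c"
      by (rule symmetric_scalar_prod_swap[OF A xc w, symmetric])
    also have "\<dots> = x c \<bullet> ?w (Suc i)" unfolding Aw using w xc by (rule comm)
    also have "\<dots> = (\<Sum>j<m. c j * (?w j \<bullet> ?w (Suc i)))"
      unfolding x_def by (rule krylov_vec_scalar_prod[OF Ac v w])
    finally show "?w i \<bullet> (A *\<^sub>v x c) = (\<Sum>j<m. c j * \<nu> (Suc (i + j)))"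
      by (simp only: krylov_power_scalar_prod[OF A v] \<nu>_def add.commute add_Suc_right)
  qed
  also have "\<dots> = hankel m (\<lambda>k. \<nu> (Suc k)) c" by (simp add: hankel_def sum_distrib_left mult.assoc)
  finally show "x c \<bullet> (A *\<^sub>v x c) = hankel m (\<lambda>k. \<nu> (Suc k)) c" .
qed

text \<open>
  Positivity of the form means that the generators are linearly independent, so the nonzero vectors of
  the Krylov subspace are exactly those with a nonzero coefficient vector.
\<close>

lemma ritz_max_hankel:
  assumes A: "A \<in> symmetric_mats n" and v: "v \<in> carrier_vec n"
  defines "\<nu> k \<equiv> v \<bullet> ((A ^\<^sub>m k) *\<^sub>v v)"
  assumes pos: "\<And>c. \<exists>i<m. c i \<noteq> 0 \<Longrightarrow> hankel m \<nu> c > 0"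
  shows "ritz_max m A v = (SUP c \<in> {c. \<exists>i<m. c i \<noteq> 0}. hankel m (\<lambda>k. \<nu> (Suc k)) c / hankel m \<nu> c)"
proof -
  have Ac: "A \<in> carrier_mat n n" using A by (rule symmetric_mats_carrier)
  note q = krylov_vec_quadratic[OF A v, of m, folded \<nu>_def]
  have "{x \<in> krylov m A v. x \<noteq> 0\<^sub>v (dim_vec v)} = krylov_vec m A v ` {c. \<exists>i<m. c i \<noteq> 0}"
  proof (intro equalityI subsetI)
    fix x assume "x \<in> {x \<in> krylov m A v. x \<noteq> 0\<^sub>v (dim_vec v)}"
    then obtain c where c: "x = krylov_vec m A v c" "x \<noteq> 0\<^sub>v (dim_vec v)"
      unfolding krylov_eq_range[OF Ac v] by auto
    have "\<exists>i<m. c i \<noteq> 0"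
    proof (rule ccontr)
      assume "\<not> (\<exists>i<m. c i \<noteq> 0)"
      then have "x = 0\<^sub>v (dim_vec v)" unfolding c(1) by (intro eq_vecI) (auto simp: krylov_vec_def)
      with c(2) show False by simp
    qed
    with c(1) show "x \<in> krylov_vec m A v ` {c. \<exists>i<m. c i \<noteq> 0}" by blast
  next
    fix x assume "x \<in> krylov_vec m A v ` {c. \<exists>i<m. c i \<noteq> 0}"
    then obtain c where c: "x = krylov_vec m A v c" "\<exists>i<m. c i \<noteq> 0" by blast
    then have "x \<bullet> x > 0" using pos q(1)[of c] by simp
    then have "x \<noteq> 0\<^sub>v (dim_vec v)" by auto
    with c(1) show "x \<in> {x \<in> krylov m A v. x \<noteq> 0\<^sub>v (dim_vec v)}"
      unfolding krylov_eq_range[OF Ac v] by blast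
  qed
  then show ?thesis unfolding ritz_max_def by (simp add: image_image q)
qed

section \<open>Finding eigenvalues from finitely many moments\<close>

text \<open>
  If \<open>f\<close> vanished at all the points \<open>e\<^sub>i\<close>, their average of a polynomial \<open>g\<close> uniformly close to \<open>f\<close>
  would be small, whereas by closeness of the moments it is near \<open>\<integral> g \<sigma> \<approx> \<integral> f \<sigma> > 0\<close>. All errors are
  kept to a quarter of \<open>s = \<integral> f \<sigma>\<close>.
\<close>

lemma moments_detect_mass:
  fixes f \<sigma> :: "real \<Rightarrow> real"
  assumes cont: "continuous_on {a..b} \<sigma>" and nonneg: "\<forall>x\<in>{a..b}. \<sigma> x \<ge> 0"
    and mass: "integral {a..b} \<sigma> = 1"
    and f: "continuous_on {a..b} f" and pos: "integral {a..b} (\<lambda>x. f x * \<sigma> x) > 0"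
  shows "\<exists>K \<delta>. \<delta> > 0 \<and> (\<forall>(n :: nat) e. n \<ge> 1 \<longrightarrow> (\<forall>i\<in>{1..n}. e i \<in> {a..b}) \<longrightarrow>
    (\<forall>k\<le>K. \<bar>(\<Sum>i=1..n. e i ^ k) / real n - integral {a..b} (\<lambda>x. x ^ k * \<sigma> x)\<bar> \<le> \<delta>) \<longrightarrow>
    (\<exists>i\<in>{1..n}. f (e i) \<noteq> 0))"
proof -
  define s where "s = integral {a..b} (\<lambda>x. f x * \<sigma> x)"
  have s: "s / 4 > 0" using pos by (simp add: s_def)
  obtain g where g: "real_polynomial_function g" "\<And>x. x \<in> {a..b} \<Longrightarrow> \<bar>f x - g x\<bar> < s / 4"
    using Stone_Weierstrass_real_polynomial_function[OF compact_Icc f s] by metis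
  obtain \<alpha> K where \<alpha>: "g = (\<lambda>x. \<Sum>k\<le>K. \<alpha> k * x ^ k)"
    using g(1) unfolding real_polynomial_function_iff_sum by blast
  define \<mu> where "\<mu> k = integral {a..b} (\<lambda>x. x ^ k * \<sigma> x)" for k
  define S where "S = (\<Sum>k\<le>K. \<bar>\<alpha> k\<bar>) + 1"
  have S: "S > 0" unfolding S_def by (simp add: add_nonneg_pos sum_nonneg)
  have int: "(\<lambda>x. h x * \<sigma> x) integrable_on {a..b}" if "continuous_on {a..b} h" for h
    by (intro integrable_continuous_real continuous_intros cont that)
  have gc: "continuous_on {a..b} g" unfolding \<alpha> by (intro continuous_intros)
  have gint: "integral {a..b} (\<lambda>x. g x * \<sigma> x) = (\<Sum>k\<le>K. \<alpha> k * \<mu> k)"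
  proof -
    have "integral {a..b} (\<lambda>x. g x * \<sigma> x) = integral {a..b} (\<lambda>x. \<Sum>k\<le>K. \<alpha> k * (x ^ k * \<sigma> x))"
      unfolding \<alpha> by (simp add: sum_distrib_right mult.assoc)
    also have "\<dots> = (\<Sum>k\<le>K. integral {a..b} (\<lambda>x. \<alpha> k * (x ^ k * \<sigma> x)))"
      by (intro integral_sum integrable_on_mult_right int continuous_intros) simp
    finally show ?thesis by (simp add: \<mu>_def)
  qed
  have "integral {a..b} (\<lambda>x. (f x - s / 4) * \<sigma> x) \<le> integral {a..b} (\<lambda>x. g x * \<sigma> x)"
  proof (intro integral_le int gc continuous_intros f mult_right_mono nonneg[rule_format])
    fix x assume "x \<in> {a..b}"
    then show "f x - s / 4 \<le> g x" using g(2)[of x] by linarith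
  qed
  moreover have "integral {a..b} (\<lambda>x. (f x - s / 4) * \<sigma> x) = s - s / 4"
  proof -
    have "integral {a..b} (\<lambda>x. (f x - s / 4) * \<sigma> x) = integral {a..b} (\<lambda>x. f x * \<sigma> x - (s / 4) * \<sigma> x)"
      by (simp add: left_diff_distrib)
    also have "\<dots> = s - (s / 4) * integral {a..b} \<sigma>"
      using int[OF f] integrable_continuous_real[OF cont]
      by (subst integral_diff) (auto simp: s_def intro: integrable_on_mult_right)
    finally show ?thesis by (simp add: mass)
  qed
  ultimately have g_large: "s - s / 4 \<le> (\<Sum>k\<le>K. \<alpha> k * \<mu> k)" by (simp add: gint)
  show ?thesis
  proof (intro exI[of _ K] exI[of _ "s / (4 * S)"] conjI allI impI)
    show "s / (4 * S) > 0" using s S by simp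
    fix n :: nat and e :: "nat \<Rightarrow> real"
    assume n: "n \<ge> 1" and e: "\<forall>i\<in>{1..n}. e i \<in> {a..b}"
      and close: "\<forall>k\<le>K. \<bar>(\<Sum>i=1..n. e i ^ k) / real n - integral {a..b} (\<lambda>x. x ^ k * \<sigma> x)\<bar> \<le> s / (4 * S)"
    show "\<exists>i\<in>{1..n}. f (e i) \<noteq> 0"
    proof (rule ccontr)
      assume "\<not> (\<exists>i\<in>{1..n}. f (e i) \<noteq> 0)"
      then have z: "g (e i) \<le> s / 4" if "i \<in> {1..n}" for i
        using g(2)[OF bspec[OF e that]] that by (smt (verit))
      define av where "av k = (\<Sum>i=1..n. e i ^ k) / real n" for k
      have "(\<Sum>k\<le>K. \<alpha> k * av k) = (\<Sum>i=1..n. g (e i)) / real n"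
      proof -
        have "(\<Sum>i=1..n. g (e i)) = (\<Sum>k\<le>K. \<Sum>i=1..n. \<alpha> k * e i ^ k)"
          unfolding \<alpha> by (rule sum.swap)
        then show ?thesis by (simp add: av_def sum_divide_distrib sum_distrib_left)
      qed
      also have "\<dots> \<le> s / 4"
        using sum_bounded_above[of "{1..n}" "\<lambda>i. g (e i)" "s / 4"] z n
        by (simp add: pos_divide_le_eq mult.commute)
      finally have upper: "(\<Sum>k\<le>K. \<alpha> k * av k) \<le> s / 4" .
      have "(\<Sum>k\<le>K. \<alpha> k * \<mu> k) - (\<Sum>k\<le>K. \<alpha> k * av k) = (\<Sum>k\<le>K. \<alpha> k * (\<mu> k - av k))"
        by (simp add: sum_subtractf right_diff_distrib)
      also have "\<dots> \<le> (\<Sum>k\<le>K. \<bar>\<alpha> k\<bar> * (s / (4 * S)))"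
      proof (intro sum_mono)
        fix k assume "k \<in> {..K}"
        then have "\<bar>\<mu> k - av k\<bar> \<le> s / (4 * S)"
          using close by (simp add: \<mu>_def av_def abs_minus_commute)
        then have "\<bar>\<alpha> k * (\<mu> k - av k)\<bar> \<le> \<bar>\<alpha> k\<bar> * (s / (4 * S))"
          unfolding abs_mult by (intro mult_left_mono) auto
        then show "\<alpha> k * (\<mu> k - av k) \<le> \<bar>\<alpha> k\<bar> * (s / (4 * S))" by linarith
      qed
      also have "\<dots> = (S - 1) * (s / (4 * S))" unfolding S_def by (simp only: add_diff_cancel flip: sum_distrib_right)
      also have "\<dots> \<le> s / 4"
      proof -
        have "(S - 1) * (s / (4 * S)) \<le> S * (s / (4 * S))"
          using s S by (intro mult_right_mono) auto
        then show ?thesis using S by simp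
      qed
      finally show False using upper g_large s by linarith
    qed
  qed
qed

section \<open>Concentration of quadratic forms in a uniform unit vector\<close>

lemma space_mat_borel [simp]: "space (mat_borel n) = carrier_mat n n"
  by (simp add: mat_borel_def)

lemma measurable_mat_borel_entry:
  assumes "i < n" "j < n"
  shows "(\<lambda>A. A $$ (i, j)) \<in> borel_measurable (mat_borel n)"
proof -
  have "(\<lambda>A. \<lambda>ij\<in>{..<n} \<times> {..<n}. A $$ ij) \<in> measurable (mat_borel n)
      (\<Pi>\<^sub>M ij\<in>{..<n} \<times> {..<n}. (borel :: real measure))"
    unfolding mat_borel_def by (rule measurable_vimage_algebra1) (auto simp: space_PiM)
  from measurable_compose[OF this measurable_component_singleton[of "(i, j)" "{..<n} \<times> {..<n}" "\<lambda>_. borel"]]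
  show ?thesis using assms by simp
qed

lemma measurable_pow_mat_entry:
  assumes "i < n" "j < n"
  shows "(\<lambda>A. (A ^\<^sub>m k) $$ (i, j)) \<in> borel_measurable (mat_borel n)"
  using assms
proof (induction k arbitrary: i j)
  case 0
  have "(\<lambda>A. (A ^\<^sub>m 0) $$ (i, j)) \<in> borel_measurable (mat_borel n) \<longleftrightarrow>
    (\<lambda>A. if i = j then 1 else 0 :: real) \<in> borel_measurable (mat_borel n)"
    using 0 by (intro measurable_cong) auto
  then show ?case by simp
next
  case (Suc k)
  have "(\<lambda>A. (A ^\<^sub>m Suc k) $$ (i, j)) \<in> borel_measurable (mat_borel n) \<longleftrightarrow>
    (\<lambda>A. \<Sum>l<n. (A ^\<^sub>m k) $$ (i, l) * A $$ (l, j)) \<in> borel_measurable (mat_borel n)"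
  proof (intro measurable_cong)
    fix A :: "real mat" assume "A \<in> space (mat_borel n)"
    then have A: "A \<in> carrier_mat n n" by simp
    show "(A ^\<^sub>m Suc k) $$ (i, j) = (\<Sum>l<n. (A ^\<^sub>m k) $$ (i, l) * A $$ (l, j))"
      using index_mult_mat_sum[OF pow_carrier_mat[OF A] A Suc.prems] by simp
  qed
  then show ?case
    using Suc by (auto intro!: borel_measurable_sum borel_measurable_times measurable_mat_borel_entry)
qed

lemma measurable_mtrace_pow:
  "(\<lambda>A. mtrace (A ^\<^sub>m k) :: real) \<in> borel_measurable (mat_borel n)"
proof -
  have "(\<lambda>A. mtrace (A ^\<^sub>m k)) \<in> borel_measurable (mat_borel n) \<longleftrightarrow>
    (\<lambda>A. \<Sum>i<n. (A ^\<^sub>m k) $$ (i, i) :: real) \<in> borel_measurable (mat_borel n)"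
    by (intro measurable_cong) (simp add: mtrace_def)
  then show ?thesis by (auto intro!: borel_measurable_sum measurable_pow_mat_entry)
qed

text \<open>
  This turns independence of variables with different value types into the notion for real variables,
  for which the expectation of a product is the product of the expectations.
\<close>

lemma indep_rvs_compose:
  fixes f :: "'b \<Rightarrow> real" and g :: "'c \<Rightarrow> real"
  assumes "prob_space M" and ind: "indep_rvs M S Y T Z"
    and f: "f \<in> borel_measurable S" and g: "g \<in> borel_measurable T"
  shows "prob_space.indep_var M borel (\<lambda>\<omega>. f (Y \<omega>)) borel (\<lambda>\<omega>. g (Z \<omega>))"
proof -
  interpret prob_space M by fact
  let ?A = "{(\<lambda>\<omega>. f (Y \<omega>)) -` A \<inter> space M |A. A \<in> sets borel}"
  let ?B = "{(\<lambda>\<omega>. g (Z \<omega>)) -` B \<inter> space M |B. B \<in> sets borel}"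
  have Y: "Y \<in> measurable M S" and Z: "Z \<in> measurable M T"
    and ind0: "indep_set {Y -` A \<inter> space M |A. A \<in> sets S} {Z -` B \<inter> space M |B. B \<in> sets T}"
    using ind by (auto simp: indep_rvs_def)
  have A: "?A \<subseteq> {Y -` A \<inter> space M |A. A \<in> sets S}"
  proof safe
    fix A :: "real set" assume "A \<in> sets borel"
    then have "f -` A \<inter> space S \<in> sets S" using f by (rule measurable_sets[rotated])
    moreover have "(\<lambda>\<omega>. f (Y \<omega>)) -` A \<inter> space M = Y -` (f -` A \<inter> space S) \<inter> space M"
      using measurable_space[OF Y] by auto
    ultimately show "\<exists>A'. (\<lambda>\<omega>. f (Y \<omega>)) -` A \<inter> space M = Y -` A' \<inter> space M \<and> A' \<in> sets S"
      by blast
  qed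
  have B: "?B \<subseteq> {Z -` B \<inter> space M |B. B \<in> sets T}"
  proof safe
    fix A :: "real set" assume "A \<in> sets borel"
    then have "g -` A \<inter> space T \<in> sets T" using g by (rule measurable_sets[rotated])
    moreover have "(\<lambda>\<omega>. g (Z \<omega>)) -` A \<inter> space M = Z -` (g -` A \<inter> space T) \<inter> space M"
      using measurable_space[OF Z] by auto
    ultimately show "\<exists>A'. (\<lambda>\<omega>. g (Z \<omega>)) -` A \<inter> space M = Z -` A' \<inter> space M \<and> A' \<in> sets T"
      by blast
  qed
  have "indep_set ?A ?B"
    unfolding indep_sets2_eq
  proof (intro conjI ballI)
    note ind1 = ind0[unfolded indep_sets2_eq]
    show "?A \<subseteq> events" using A ind1 by (meson subset_trans)
    show "?B \<subseteq> events" using B ind1 by (meson subset_trans)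
    fix x y assume "x \<in> ?A" "y \<in> ?B"
    then show "prob (x \<inter> y) = prob x * prob y" using A B ind1 by (meson subsetD)
  qed
  moreover have "Int_stable ?A"
  proof (rule Int_stableI, safe)
    fix A B :: "real set" assume "A \<in> sets borel" "B \<in> sets borel"
    then show "\<exists>C. (\<lambda>\<omega>. f (Y \<omega>)) -` A \<inter> space M \<inter> ((\<lambda>\<omega>. f (Y \<omega>)) -` B \<inter> space M)
      = (\<lambda>\<omega>. f (Y \<omega>)) -` C \<inter> space M \<and> C \<in> sets borel"
      by (intro exI[of _ "A \<inter> B"]) auto
  qed
  moreover have "Int_stable ?B"
  proof (rule Int_stableI, safe)
    fix A B :: "real set" assume "A \<in> sets borel" "B \<in> sets borel"
    then show "\<exists>C. (\<lambda>\<omega>. g (Z \<omega>)) -` A \<inter> space M \<inter> ((\<lambda>\<omega>. g (Z \<omega>)) -` B \<inter> space M)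
      = (\<lambda>\<omega>. g (Z \<omega>)) -` C \<inter> space M \<and> C \<in> sets borel"
      by (intro exI[of _ "A \<inter> B"]) auto
  qed
  ultimately have "indep_set (sigma_sets (space M) ?A) (sigma_sets (space M) ?B)"
    by (rule indep_set_sigma_sets)
  then show ?thesis
    unfolding indep_var_eq using measurable_compose[OF Y f] measurable_compose[OF Z g] by blast
qed

text \<open>
  Expand the square into products \<open>D\<^sub>i\<^sub>j D\<^sub>k\<^sub>l \<cdot> V\<^sub>i V\<^sub>j V\<^sub>k V\<^sub>l\<close> and integrate the two factors separately. Of
  the three pairings in the fourth moments of \<open>V\<close>, the pairing \<open>i = j\<close>, \<open>k = l\<close> sums to the squared
  trace of \<open>D\<close>, which is zero, and each of the other two to the squared Frobenius norm, by the symmetry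
  of \<open>D\<close>.
\<close>

lemma quadratic_form_second_moment:
  fixes X :: "'a \<Rightarrow> real mat" and V :: "'a \<Rightarrow> real vec" and D :: "nat \<Rightarrow> nat \<Rightarrow> real mat \<Rightarrow> real"
  assumes "prob_space M" and n: "n \<ge> 2"
    and ind: "indep_rvs M (mat_borel n) X (vec_borel n) V"
    and unif: "distr M (vec_borel n) V = uniform_sphere n"
    and D: "\<And>i j. i < n \<Longrightarrow> j < n \<Longrightarrow> D i j \<in> borel_measurable (mat_borel n)"
    and sym: "\<And>i j \<omega>. \<lbrakk>i < n; j < n; \<omega> \<in> space M\<rbrakk> \<Longrightarrow> D j i (X \<omega>) = D i j (X \<omega>)"
    and tr: "\<And>\<omega>. \<omega> \<in> space M \<Longrightarrow> (\<Sum>i<n. D i i (X \<omega>)) = 0"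
    and frob: "\<And>\<omega>. \<omega> \<in> space M \<Longrightarrow> (\<Sum>i<n. \<Sum>j<n. (D i j (X \<omega>))\<^sup>2) \<le> R"
  shows "integrable M (\<lambda>\<omega>. (\<Sum>i<n. \<Sum>j<n. D i j (X \<omega>) * (V \<omega> $ i * V \<omega> $ j))\<^sup>2)" (is ?int)
    and "(\<integral>\<omega>. (\<Sum>i<n. \<Sum>j<n. D i j (X \<omega>) * (V \<omega> $ i * V \<omega> $ j))\<^sup>2 \<partial>M)
      \<le> 2 * R / (real n * (real n + 2))" (is ?bound)
proof -
  interpret prob_space M by fact
  have X[measurable]: "X \<in> measurable M (mat_borel n)" and V[measurable]: "V \<in> measurable M (vec_borel n)"
    using ind by (auto simp: indep_rvs_def)
  have pU: "prob_space (uniform_sphere n)" unfolding unif[symmetric] by (rule prob_space_distr[OF V])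
  define I where "I = {..<n} \<times> {..<n}"
  have fin: "finite I" by (simp add: I_def)
  define d where "d p \<omega> = D (fst p) (snd p) (X \<omega>)" for p \<omega>
  define u where "u p \<omega> = V \<omega> $ fst p * V \<omega> $ snd p" for p \<omega>
  define N where "N = real n * (real n + 2)"
  have N: "N > 0" using n by (simp add: N_def)
  define w :: "nat \<times> nat \<Rightarrow> nat \<times> nat \<Rightarrow> real" where
    "w p q = (of_bool (fst p = snd p \<and> fst q = snd q) + of_bool (q = p) + of_bool (q = (snd p, fst p))) / N" for p q
  have sum_I: "(\<Sum>p\<in>I. h (fst p) (snd p)) = (\<Sum>i<n. \<Sum>j<n. h i j)" for h :: "nat \<Rightarrow> nat \<Rightarrow> real"
    by (simp add: I_def sum.cartesian_product case_prod_beta)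
  have bound: "\<bar>d p \<omega>\<bar> \<le> R + 1" if "p \<in> I" "\<omega> \<in> space M" for p \<omega>
  proof -
    have "(d p \<omega>)\<^sup>2 \<le> (\<Sum>p\<in>I. (d p \<omega>)\<^sup>2)" using that fin by (intro member_le_sum) auto
    also have "\<dots> \<le> R" unfolding d_def using frob[OF that(2)] by (subst sum_I) simp
    finally have "\<bar>d p \<omega>\<bar>\<^sup>2 \<le> R" by simp
    moreover have "0 \<le> (\<bar>d p \<omega>\<bar> - 1)\<^sup>2" by simp
    ultimately show ?thesis by (simp add: power2_diff)
  qed
  have int_d: "integrable M (\<lambda>\<omega>. d p \<omega> * d q \<omega>)" if "p \<in> I" "q \<in> I" for p q
  proof (rule integrable_const_bound[where B = "(R + 1) * (R + 1)"])
    show "AE \<omega> in M. norm (d p \<omega> * d q \<omega>) \<le> (R + 1) * (R + 1)"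
    proof (intro AE_I2)
      fix \<omega> assume "\<omega> \<in> space M"
      then have "\<bar>d p \<omega>\<bar> \<le> R + 1" "\<bar>d q \<omega>\<bar> \<le> R + 1" using bound that by auto
      then show "norm (d p \<omega> * d q \<omega>) \<le> (R + 1) * (R + 1)"
        unfolding real_norm_def abs_mult by (intro mult_mono) auto
    qed
    show "(\<lambda>\<omega>. d p \<omega> * d q \<omega>) \<in> borel_measurable M"
      unfolding d_def using that
      by (intro borel_measurable_times measurable_compose[OF X D]) (auto simp: I_def)
  qed
  have u: "integrable M (\<lambda>\<omega>. u p \<omega> * u q \<omega>)" "(\<integral>\<omega>. u p \<omega> * u q \<omega> \<partial>M) = w p q"
    if pq: "p \<in> I" "q \<in> I" for p q
  proof -
    obtain i j k l where ijkl: "p = (i, j)" "q = (k, l)" "i < n" "j < n" "k < n" "l < n"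
      using pq by (auto simp: I_def)
    let ?h = "\<lambda>x :: real vec. x $ i * x $ j * x $ k * x $ l"
    have h: "?h \<in> borel_measurable (vec_borel n)"
      using ijkl by (intro borel_measurable_times measurable_vec_borel_component)
    have eq: "u p \<omega> * u q \<omega> = ?h (V \<omega>)" for \<omega> by (simp add: u_def ijkl mult.assoc)
    have "integrable (uniform_sphere n) ?h"
      using sphere_integrable[OF n pU] ijkl by blast
    then show "integrable M (\<lambda>\<omega>. u p \<omega> * u q \<omega>)"
      unfolding eq unif[symmetric] by (subst (asm) integrable_distr_eq[OF V h])
    have "(\<integral>\<omega>. u p \<omega> * u q \<omega> \<partial>M) = (\<integral>x. ?h x \<partial>uniform_sphere n)"
      unfolding eq unif[symmetric] by (rule integral_distr[OF V h, symmetric])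
    also have "\<dots> = w p q"
    proof -
      have "(fst p = snd p \<and> fst q = snd q) = (i = j \<and> k = l)" "(q = p) = (i = k \<and> j = l)"
        "(q = (snd p, fst p)) = (i = l \<and> j = k)"
        by (auto simp: ijkl(1,2))
      then show ?thesis
        unfolding sphere_fourth_moment[OF n pU ijkl(3-6)] w_def N_def by (simp only:)
    qed
    finally show "(\<integral>\<omega>. u p \<omega> * u q \<omega> \<partial>M) = w p q" .
  qed
  have iv: "indep_var borel (\<lambda>\<omega>. d p \<omega> * d q \<omega>) borel (\<lambda>\<omega>. u p \<omega> * u q \<omega>)" if "p \<in> I" "q \<in> I" for p q
    unfolding d_def u_def using that
    by (intro indep_rvs_compose[OF prob_space_axioms ind,
          where f = "\<lambda>A. D (fst p) (snd p) A * D (fst q) (snd q) A"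
          and g = "\<lambda>x. x $ fst p * x $ snd p * (x $ fst q * x $ snd q)"]
        borel_measurable_times measurable_vec_borel_component D) (auto simp: I_def)
  have int_du: "integrable M (\<lambda>\<omega>. d p \<omega> * d q \<omega> * (u p \<omega> * u q \<omega>))" if "p \<in> I" "q \<in> I" for p q
    by (rule indep_var_integrable[OF iv int_d u(1)]) (fact that)+
  have swap: "(\<integral>\<omega>. (\<Sum>p\<in>I. \<Sum>q\<in>I. F p q \<omega>) \<partial>M) = (\<Sum>p\<in>I. \<Sum>q\<in>I. \<integral>\<omega>. F p q \<omega> \<partial>M)"
    if F: "\<And>p q. p \<in> I \<Longrightarrow> q \<in> I \<Longrightarrow> integrable M (F p q)" for F :: "_ \<Rightarrow> _ \<Rightarrow> _ \<Rightarrow> real"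
  proof -
    have "(\<integral>\<omega>. (\<Sum>p\<in>I. \<Sum>q\<in>I. F p q \<omega>) \<partial>M) = (\<Sum>p\<in>I. \<integral>\<omega>. (\<Sum>q\<in>I. F p q \<omega>) \<partial>M)"
      using F by (intro Bochner_Integration.integral_sum Bochner_Integration.integrable_sum)
    also have "\<dots> = (\<Sum>p\<in>I. \<Sum>q\<in>I. \<integral>\<omega>. F p q \<omega> \<partial>M)"
      using F by (intro sum.cong refl Bochner_Integration.integral_sum)
    finally show ?thesis .
  qed
  have E_du: "(\<integral>\<omega>. d p \<omega> * d q \<omega> * (u p \<omega> * u q \<omega>) \<partial>M) = (\<integral>\<omega>. d p \<omega> * d q \<omega> * w p q \<partial>M)"
    if "p \<in> I" "q \<in> I" for p q
    using indep_var_lebesgue_integral[OF iv int_d u(1)] u(2) that by simp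
  have square: "(\<Sum>i<n. \<Sum>j<n. D i j (X \<omega>) * (V \<omega> $ i * V \<omega> $ j))\<^sup>2
    = (\<Sum>p\<in>I. \<Sum>q\<in>I. d p \<omega> * d q \<omega> * (u p \<omega> * u q \<omega>))" for \<omega>
  proof -
    have "(\<Sum>i<n. \<Sum>j<n. D i j (X \<omega>) * (V \<omega> $ i * V \<omega> $ j)) = (\<Sum>p\<in>I. d p \<omega> * u p \<omega>)"
      unfolding d_def u_def by (rule sum_I[symmetric])
    then have "(\<Sum>i<n. \<Sum>j<n. D i j (X \<omega>) * (V \<omega> $ i * V \<omega> $ j))\<^sup>2
      = (\<Sum>p\<in>I. \<Sum>q\<in>I. d p \<omega> * u p \<omega> * (d q \<omega> * u q \<omega>))"
      by (simp only: power2_eq_square sum_product)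
    then show ?thesis by (simp only: mult_ac)
  qed
  show ?int unfolding square by (intro Bochner_Integration.integrable_sum int_du)
  have "(\<integral>\<omega>. (\<Sum>i<n. \<Sum>j<n. D i j (X \<omega>) * (V \<omega> $ i * V \<omega> $ j))\<^sup>2 \<partial>M)
    = (\<Sum>p\<in>I. \<Sum>q\<in>I. (\<integral>\<omega>. d p \<omega> * d q \<omega> * (u p \<omega> * u q \<omega>) \<partial>M))"
    unfolding square by (rule swap) (rule int_du)
  also have "\<dots> = (\<Sum>p\<in>I. \<Sum>q\<in>I. (\<integral>\<omega>. d p \<omega> * d q \<omega> * w p q \<partial>M))"
    using E_du by (intro sum.cong refl) auto
  also have "\<dots> = (\<integral>\<omega>. (\<Sum>p\<in>I. \<Sum>q\<in>I. d p \<omega> * d q \<omega> * w p q) \<partial>M)"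
    by (rule swap[symmetric]) (intro integrable_mult_left int_d)
  also have "\<dots> \<le> (\<integral>\<omega>. 2 * R / N \<partial>M)"
  proof (intro integral_mono)
    show "integrable M (\<lambda>\<omega>. \<Sum>p\<in>I. \<Sum>q\<in>I. d p \<omega> * d q \<omega> * w p q)"
      using int_d by (intro Bochner_Integration.integrable_sum integrable_mult_left) auto
    show "integrable M (\<lambda>\<omega>. 2 * R / N)" by simp
    fix \<omega> assume \<omega>: "\<omega> \<in> space M"
    have "(\<Sum>p\<in>I. \<Sum>q\<in>I. d p \<omega> * d q \<omega> * w p q) * N
      = (\<Sum>p\<in>I. \<Sum>q\<in>I. (d p \<omega> * of_bool (fst p = snd p)) * (d q \<omega> * of_bool (fst q = snd q)))
       + (\<Sum>p\<in>I. \<Sum>q\<in>I. if q = p then d p \<omega> * d q \<omega> else 0)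
       + (\<Sum>p\<in>I. \<Sum>q\<in>I. if q = (snd p, fst p) then d p \<omega> * d q \<omega> else 0)"
      unfolding sum_distrib_right sum.distrib[symmetric]
    proof (intro sum.cong refl)
      fix p q
      have "w p q * N = of_bool (fst p = snd p) * of_bool (fst q = snd q) + of_bool (q = p)
          + of_bool (q = (snd p, fst p))"
        using N by (simp add: w_def of_bool_conj)
      then have "d p \<omega> * d q \<omega> * w p q * N = d p \<omega> * d q \<omega> * (of_bool (fst p = snd p) * of_bool (fst q = snd q)
          + of_bool (q = p) + of_bool (q = (snd p, fst p)))"
        by (simp only: mult.assoc)
      then show "d p \<omega> * d q \<omega> * w p q * N
        = d p \<omega> * of_bool (fst p = snd p) * (d q \<omega> * of_bool (fst q = snd q))
         + (if q = p then d p \<omega> * d q \<omega> else 0) + (if q = (snd p, fst p) then d p \<omega> * d q \<omega> else 0)"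
        by (simp add: distrib_left of_bool_def)
    qed
    also have "(\<Sum>p\<in>I. \<Sum>q\<in>I. (d p \<omega> * of_bool (fst p = snd p)) * (d q \<omega> * of_bool (fst q = snd q)))
      = (\<Sum>p\<in>I. d p \<omega> * of_bool (fst p = snd p))\<^sup>2"
      by (simp only: power2_eq_square sum_product)
    also have "(\<Sum>p\<in>I. d p \<omega> * of_bool (fst p = snd p)) = (\<Sum>i<n. \<Sum>j<n. D i j (X \<omega>) * of_bool (i = j))"
      unfolding d_def by (rule sum_I)
    also have "\<dots> = (\<Sum>i<n. D i i (X \<omega>))"
      by (intro sum.cong refl) (simp add: of_bool_def if_distrib cong: if_cong)
    also have "\<dots> = 0" by (rule tr[OF \<omega>])
    also have "(\<Sum>p\<in>I. \<Sum>q\<in>I. if q = p then d p \<omega> * d q \<omega> else 0) = (\<Sum>p\<in>I. (d p \<omega>)\<^sup>2)"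
      using fin by (simp add: power2_eq_square)
    also have "(\<Sum>p\<in>I. \<Sum>q\<in>I. if q = (snd p, fst p) then d p \<omega> * d q \<omega> else 0) = (\<Sum>p\<in>I. (d p \<omega>)\<^sup>2)"
    proof (intro sum.cong refl)
      fix p assume p: "p \<in> I"
      then have "(snd p, fst p) \<in> I" by (auto simp: I_def)
      moreover have "d (snd p, fst p) \<omega> = d p \<omega>" using sym \<omega> p by (auto simp: d_def I_def)
      ultimately show "(\<Sum>q\<in>I. if q = (snd p, fst p) then d p \<omega> * d q \<omega> else 0) = (d p \<omega>)\<^sup>2"
        using fin by (simp add: power2_eq_square)
    qed
    also have "(\<Sum>p\<in>I. (d p \<omega>)\<^sup>2) = (\<Sum>i<n. \<Sum>j<n. (D i j (X \<omega>))\<^sup>2)"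
      unfolding d_def by (rule sum_I)
    also have "0\<^sup>2 + \<dots> + \<dots> \<le> 2 * R" using frob[OF \<omega>] by simp
    finally show "(\<Sum>p\<in>I. \<Sum>q\<in>I. d p \<omega> * d q \<omega> * w p q) \<le> 2 * R / N"
      using N by (simp add: pos_le_divide_eq)
  qed
  also have "\<dots> = 2 * R / N" by (simp add: prob_space)
  finally show ?bound unfolding N_def .
qed

text \<open>
  For a unit vector, subtracting \<open>tr(X\<^sup>k)/n\<close> from \<open>V\<^sup>T X\<^sup>k V\<close> amounts to replacing \<open>X\<^sup>k\<close> by its trace-free
  part \<open>D\<close>, whose Frobenius norm is at most that of \<open>X\<^sup>k\<close>. The exceptional event \<open>E\<close> consists of the
  large deviations of this quadratic form, bounded by Markov's inequality, and of the null event that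
  \<open>V\<close> is not a unit vector.
\<close>

lemma krylov_moment_concentration:
  fixes X :: "'a \<Rightarrow> real mat" and V :: "'a \<Rightarrow> real vec"
  assumes M: "prob_space M" and n: "n \<ge> 2"
    and ind: "indep_rvs M (mat_borel n) X (vec_borel n) V"
    and unif: "distr M (vec_borel n) V = uniform_sphere n"
    and X: "\<And>\<omega>. \<omega> \<in> space M \<Longrightarrow> X \<omega> \<in> symmetric_mats n"
    and eig: "\<And>\<omega> i. \<omega> \<in> space M \<Longrightarrow> i \<in> {1..n} \<Longrightarrow> \<bar>eig (X \<omega>) i\<bar> \<le> C"
    and \<delta>: "\<delta> > 0"
  obtains E where "E \<in> sets M" "measure M E \<le> 2 * C ^ (2 * k) / ((real n + 2) * \<delta>\<^sup>2)"
    "\<And>\<omega>. \<omega> \<in> space M - E \<Longrightarrow>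
      \<bar>V \<omega> \<bullet> ((X \<omega> ^\<^sub>m k) *\<^sub>v V \<omega>) - mtrace (X \<omega> ^\<^sub>m k) / real n\<bar> < \<delta>"
proof -
  interpret prob_space M by fact
  have mX[measurable]: "X \<in> measurable M (mat_borel n)" and mV[measurable]: "V \<in> measurable M (vec_borel n)"
    using ind by (auto simp: indep_rvs_def)
  define t where "t A = mtrace (A ^\<^sub>m k) / real n" for A :: "real mat"
  define D where "D i j A = (A ^\<^sub>m k) $$ (i, j) - (if i = j then t A else 0)" for i j and A :: "real mat"
  define R where "R = real n * C ^ (2 * k)"
  have D_meas: "D i j \<in> borel_measurable (mat_borel n)" if "i < n" "j < n" for i j
    unfolding D_def t_def using that measurable_mtrace_pow[of k n]
    by (cases "i = j") (auto intro!: borel_measurable_diff measurable_pow_mat_entry borel_measurable_divide)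
  have D_sym: "D j i (X \<omega>) = D i j (X \<omega>)" if "i < n" "j < n" "\<omega> \<in> space M" for i j \<omega>
    using symmetric_mats_entry[OF pow_mat_symmetric[OF X[OF that(3)]] that(1,2), of k] by (simp add: D_def)
  have diag: "(\<Sum>i<n. (X \<omega> ^\<^sub>m k) $$ (i, i)) = real n * t (X \<omega>)" if "\<omega> \<in> space M" for \<omega>
    using symmetric_mats_carrier[OF X[OF that]] n by (simp add: t_def mtrace_def)
  have D_tr: "(\<Sum>i<n. D i i (X \<omega>)) = 0" if "\<omega> \<in> space M" for \<omega>
    using diag[OF that] by (simp add: D_def sum_subtractf)
  have D_frob: "(\<Sum>i<n. \<Sum>j<n. (D i j (X \<omega>))\<^sup>2) \<le> R" if \<omega>: "\<omega> \<in> space M" for \<omega>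
  proof -
    let ?Q = "\<lambda>i j. (X \<omega> ^\<^sub>m k) $$ (i, j)"
    have "(D i j (X \<omega>))\<^sup>2 = (?Q i j)\<^sup>2 + (if j = i then (t (X \<omega>))\<^sup>2 - 2 * t (X \<omega>) * ?Q i i else 0)" for i j
      by (simp add: D_def power2_diff)
    then have "(\<Sum>i<n. \<Sum>j<n. (D i j (X \<omega>))\<^sup>2)
      = (\<Sum>i<n. \<Sum>j<n. (?Q i j)\<^sup>2) + (\<Sum>i<n. (t (X \<omega>))\<^sup>2 - 2 * t (X \<omega>) * ?Q i i)"
      by (simp add: sum.distrib)
    also have "(\<Sum>i<n. (t (X \<omega>))\<^sup>2 - 2 * t (X \<omega>) * ?Q i i) = - (real n * (t (X \<omega>))\<^sup>2)"
      by (simp add: sum_subtractf diag[OF \<omega>] power2_eq_square flip: sum_distrib_left)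
    also have "(\<Sum>i<n. \<Sum>j<n. (?Q i j)\<^sup>2) = (\<Sum>i=1..n. eig (X \<omega>) i ^ (2 * k))"
      by (rule symmetric_frobenius[OF X[OF \<omega>]])
    finally have "(\<Sum>i<n. \<Sum>j<n. (D i j (X \<omega>))\<^sup>2) \<le> (\<Sum>i=1..n. eig (X \<omega>) i ^ (2 * k))"
      using mult_nonneg_nonneg[of "real n" "(t (X \<omega>))\<^sup>2"] by simp
    also have "\<dots> \<le> (\<Sum>i=1..n. C ^ (2 * k))"
    proof (intro sum_mono)
      fix i assume "i \<in> {1..n}"
      then have "\<bar>eig (X \<omega>) i\<bar> ^ (2 * k) \<le> C ^ (2 * k)" using eig[OF \<omega>] by (intro power_mono) auto
      then show "eig (X \<omega>) i ^ (2 * k) \<le> C ^ (2 * k)" by (simp add: power_even_abs)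
    qed
    finally show ?thesis by (simp add: R_def)
  qed
  define Z where "Z \<omega> = (\<Sum>i<n. \<Sum>j<n. D i j (X \<omega>) * (V \<omega> $ i * V \<omega> $ j))" for \<omega>
  note second = quadratic_form_second_moment[OF M n ind unif D_meas D_sym D_tr D_frob, folded Z_def]
  have Z_meas[measurable]: "Z \<in> borel_measurable M"
    unfolding Z_def
    by (intro borel_measurable_sum borel_measurable_times measurable_compose[OF mX D_meas]
        measurable_compose[OF mV measurable_vec_borel_component]) auto
  define E1 where "E1 = {\<omega> \<in> space M. (Z \<omega>)\<^sup>2 \<ge> \<delta>\<^sup>2}"
  define E2 where "E2 = {\<omega> \<in> space M. vnorm (V \<omega>) \<noteq> 1}"
  have E1: "E1 \<in> sets M" unfolding E1_def by measurable
  have vm: "(\<lambda>\<omega>. vnorm (V \<omega>)) \<in> borel_measurable M"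
    by (rule measurable_compose[OF mV borel_measurable_vnorm])
  then have E2: "E2 \<in> sets M" unfolding E2_def by measurable
  have "measure M E1 \<le> (\<integral>\<omega>. (Z \<omega>)\<^sup>2 \<partial>M) / \<delta>\<^sup>2"
    unfolding E1_def using second(1) \<delta>
    by (intro integral_Markov_inequality_measure[where A = "{}"]) auto
  also have "\<dots> \<le> (2 * R / (real n * (real n + 2))) / \<delta>\<^sup>2"
    using second(2) by (intro divide_right_mono) auto
  also have "\<dots> = 2 * C ^ (2 * k) / ((real n + 2) * \<delta>\<^sup>2)"
    using n by (simp add: R_def)
  finally have mE1: "measure M E1 \<le> 2 * C ^ (2 * k) / ((real n + 2) * \<delta>\<^sup>2)" .
  have "AE x in distr M (vec_borel n) V. vnorm x = 1"
    unfolding unif using n by (intro AE_uniform_sphere_vnorm) auto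
  then have "AE \<omega> in M. vnorm (V \<omega>) = 1" by (rule AE_distrD[OF mV])
  then have mE2: "measure M E2 = 0"
    unfolding E2_def using E2[unfolded E2_def] by (subst prob_Collect_eq_0) auto
  show thesis
  proof (rule that)
    show "E1 \<union> E2 \<in> sets M" using E1 E2 by blast
    show "measure M (E1 \<union> E2) \<le> 2 * C ^ (2 * k) / ((real n + 2) * \<delta>\<^sup>2)"
      using measure_Un_le[OF E1 E2] mE1 mE2 by simp
    fix \<omega> assume "\<omega> \<in> space M - (E1 \<union> E2)"
    then have \<omega>: "\<omega> \<in> space M" "(Z \<omega>)\<^sup>2 < \<delta>\<^sup>2" "vnorm (V \<omega>) = 1"
      by (auto simp: E1_def E2_def)
    have v: "V \<omega> \<in> carrier_vec n" using measurable_space[OF mV \<omega>(1)] by simp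
    have Xc: "X \<omega> ^\<^sub>m k \<in> carrier_mat n n"
      using symmetric_mats_carrier[OF X[OF \<omega>(1)]] by simp
    have unit: "(\<Sum>i<n. (V \<omega> $ i)\<^sup>2) = 1" using \<omega>(3) by (simp add: vnorm_eq[OF v])
    have "V \<omega> \<bullet> ((X \<omega> ^\<^sub>m k) *\<^sub>v V \<omega>)
      = (\<Sum>i<n. V \<omega> $ i * (\<Sum>j<n. (X \<omega> ^\<^sub>m k) $$ (i, j) * V \<omega> $ j))"
      unfolding scalar_prod_sum[OF mult_mat_vec_carrier[OF Xc v]]
      by (intro sum.cong refl) (simp add: index_mult_mat_vec_sum[OF Xc v] del: index_mult_mat_vec)
    also have "\<dots> = (\<Sum>i<n. \<Sum>j<n. (X \<omega> ^\<^sub>m k) $$ (i, j) * (V \<omega> $ i * V \<omega> $ j))"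
      by (simp only: sum_distrib_left mult.left_commute)
    finally have quad: "V \<omega> \<bullet> ((X \<omega> ^\<^sub>m k) *\<^sub>v V \<omega>) = \<dots>" .
    have "Z \<omega> = (\<Sum>i<n. \<Sum>j<n. (X \<omega> ^\<^sub>m k) $$ (i, j) * (V \<omega> $ i * V \<omega> $ j)
        - (if j = i then t (X \<omega>) * (V \<omega> $ i)\<^sup>2 else 0))"
      unfolding Z_def D_def by (intro sum.cong refl) (auto simp: left_diff_distrib power2_eq_square)
    also have "\<dots> = V \<omega> \<bullet> ((X \<omega> ^\<^sub>m k) *\<^sub>v V \<omega>) - t (X \<omega>)"
      using unit by (simp add: quad sum_subtractf flip: sum_distrib_left)
    finally have "Z \<omega> = V \<omega> \<bullet> ((X \<omega> ^\<^sub>m k) *\<^sub>v V \<omega>) - t (X \<omega>)" .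
    moreover have "\<bar>Z \<omega>\<bar> < \<delta>" using \<omega>(2) \<delta> by (metis abs_less_iff abs_of_pos power2_abs power_less_imp_less_base less_imp_le)
    ultimately show "\<bar>V \<omega> \<bullet> ((X \<omega> ^\<^sub>m k) *\<^sub>v V \<omega>) - mtrace (X \<omega> ^\<^sub>m k) / real n\<bar> < \<delta>"
      by (simp add: t_def)
  qed
qed

section \<open>The limit of the empirical spectral distributions\<close>

lemma expectation_esd:
  assumes "A \<in> symmetric_mats n" "n \<ge> 1"
  shows "measure_pmf.expectation (esd A) f = (\<Sum>i=1..n. f (eig A i)) / real n"
proof -
  have "dim_row A = n" using symmetric_mats_carrier[OF assms(1)] by simp
  then show ?thesis using assms(2)
    by (simp add: esd_def integral_map_pmf integral_pmf_of_set)
qed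

context
  fixes a b :: real and \<sigma> :: "real \<Rightarrow> real"
    and M :: "nat \<Rightarrow> 'a measure" and X :: "nat \<Rightarrow> 'a \<Rightarrow> real mat"
  assumes ab: "a < b"
    and prob: "\<And>n. n \<ge> 1 \<Longrightarrow> prob_space (M n)"
    and symm: "\<And>n \<omega>. n \<ge> 1 \<Longrightarrow> \<omega> \<in> space (M n) \<Longrightarrow> X n \<omega> \<in> symmetric_mats n"
    and eig_range: "\<And>n \<omega> i. n \<ge> 1 \<Longrightarrow> \<omega> \<in> space (M n) \<Longrightarrow> i \<in> {1..n} \<Longrightarrow> eig (X n \<omega>) i \<in> {a..b}"
    and cont: "continuous_on {a..b} \<sigma>"
    and conv: "esd_tendsto_in_prob M X a b \<sigma>"
begin

text \<open>
  An inequality that held for every outcome would have probability one, for every \<open>n\<close>. Properties of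
  \<open>\<sigma>\<close> follow by comparing its integrals with those of the empirical distribution at a single outcome.
\<close>

lemma esd_limit_no_sure_deviation:
  assumes f: "continuous_on {a..b} f" and \<epsilon>: "\<epsilon> > 0"
  shows "\<exists>n \<omega>. n \<ge> 1 \<and> \<omega> \<in> space (M n) \<and>
    \<bar>measure_pmf.expectation (esd (X n \<omega>)) f - integral {a..b} (\<lambda>x. f x * \<sigma> x)\<bar> \<le> \<epsilon>"
proof (rule ccontr)
  assume *: "\<not> ?thesis"
  let ?P = "\<lambda>n. measure (M n) {\<omega> \<in> space (M n).
    \<bar>measure_pmf.expectation (esd (X n \<omega>)) f - integral {a..b} (\<lambda>x. f x * \<sigma> x)\<bar> > \<epsilon>}"
  have "?P n = 1" if "n \<ge> 1" for n
  proof -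
    have "{\<omega> \<in> space (M n). \<bar>measure_pmf.expectation (esd (X n \<omega>)) f - integral {a..b} (\<lambda>x. f x * \<sigma> x)\<bar> > \<epsilon>}
      = space (M n)" using * that by force
    then show ?thesis using prob_space.prob_space[OF prob[OF that]] by simp
  qed
  then have "\<forall>\<^sub>F n in sequentially. ?P n = 1"
    by (auto simp: eventually_sequentially)
  then have "?P \<longlonglongrightarrow> 1" by (rule tendsto_eventually)
  moreover have "?P \<longlonglongrightarrow> 0" using conv f \<epsilon> unfolding esd_tendsto_in_prob_def by blast
  ultimately show False using LIMSEQ_unique by fastforce
qed

lemma esd_limit_mass: "integral {a..b} \<sigma> = 1"
proof (rule ccontr)
  assume *: "integral {a..b} \<sigma> \<noteq> 1"
  obtain n \<omega> where n: "n \<ge> 1" "\<omega> \<in> space (M n)"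
    "\<bar>measure_pmf.expectation (esd (X n \<omega>)) (\<lambda>_. 1) - integral {a..b} (\<lambda>x. 1 * \<sigma> x)\<bar>
      \<le> \<bar>1 - integral {a..b} \<sigma>\<bar> / 2"
    using esd_limit_no_sure_deviation[of "\<lambda>_. 1" "\<bar>1 - integral {a..b} \<sigma>\<bar> / 2"] * by auto
  then show False using * by simp
qed

lemma esd_limit_integral_nonneg:
  assumes f: "continuous_on {a..b} f" and nn: "\<And>x. x \<in> {a..b} \<Longrightarrow> f x \<ge> 0"
  shows "integral {a..b} (\<lambda>x. f x * \<sigma> x) \<ge> 0"
proof (rule ccontr)
  define s where "s = - integral {a..b} (\<lambda>x. f x * \<sigma> x)"
  assume "\<not> integral {a..b} (\<lambda>x. f x * \<sigma> x) \<ge> 0"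
  then have s: "s > 0" by (simp add: s_def)
  obtain n \<omega> where n: "n \<ge> 1" "\<omega> \<in> space (M n)"
    "\<bar>measure_pmf.expectation (esd (X n \<omega>)) f - integral {a..b} (\<lambda>x. f x * \<sigma> x)\<bar> \<le> s / 2"
    using esd_limit_no_sure_deviation[OF f, of "s / 2"] s by auto
  have "measure_pmf.expectation (esd (X n \<omega>)) f \<ge> 0"
    unfolding expectation_esd[OF symm[OF n(1,2)] n(1)]
    using eig_range[OF n(1,2)] nn by (intro divide_nonneg_nonneg sum_nonneg) auto
  then show False using n(3) s by (simp add: s_def abs_le_iff)
qed

text \<open>
  The negative part of \<open>\<sigma>\<close> is a legitimate test function, and its integral against \<open>\<sigma>\<close> is minus the
  integral of its square.
\<close>

lemma esd_limit_nonneg: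
  assumes x: "x \<in> {a..b}"
  shows "\<sigma> x \<ge> 0"
proof (rule ccontr)
  assume neg: "\<not> \<sigma> x \<ge> 0"
  define f where "f y = max 0 (- \<sigma> y)" for y
  have f: "continuous_on {a..b} f" unfolding f_def by (intro continuous_intros cont)
  have c: "continuous_on {a..b} (\<lambda>y. - (f y * \<sigma> y))" by (intro continuous_intros cont f)
  have nn: "- (f y * \<sigma> y) \<ge> 0" for y by (simp add: f_def max_def mult_le_0_iff)
  have "integral {a..b} (\<lambda>y. f y * \<sigma> y) \<ge> 0"
    by (intro esd_limit_integral_nonneg f) (simp add: f_def)
  moreover have "integral {a..b} (\<lambda>y. - (f y * \<sigma> y)) \<ge> 0"
    by (intro integral_nonneg integrable_continuous_real c nn)
  ultimately have "integral {a..b} (\<lambda>y. - (f y * \<sigma> y)) = 0" by simp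
  then have "- (f x * \<sigma> x) = 0" using integral_eq_0_iff[OF c ab nn] x by blast
  with neg show False by (simp add: f_def max_def)
qed

lemma weight_positive_near_support:
  assumes f: "continuous_on {a..b} f" and nn: "\<And>x. x \<in> {a..b} \<Longrightarrow> f x \<ge> 0"
    and y: "y \<in> support_within a b \<sigma>" and \<eta>: "\<eta> > 0"
    and pos: "\<And>x. x \<in> {a..b} \<Longrightarrow> \<bar>x - y\<bar> < \<eta> \<Longrightarrow> f x > 0"
  shows "integral {a..b} (\<lambda>x. f x * \<sigma> x) > 0"
proof -
  obtain x where x: "x \<in> {a..b}" "\<sigma> x \<noteq> 0" "dist x y < \<eta>"
    using y \<eta> unfolding support_within_def closure_approachable by blast
  have c: "continuous_on {a..b} (\<lambda>x. f x * \<sigma> x)" by (intro continuous_intros cont f)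
  have fs: "f x * \<sigma> x \<ge> 0" if "x \<in> {a..b}" for x using nn esd_limit_nonneg that by simp
  have "f x * \<sigma> x \<noteq> 0" using x pos[of x] by (simp add: dist_real_def)
  then have "integral {a..b} (\<lambda>x. f x * \<sigma> x) \<noteq> 0" using integral_eq_0_iff[OF c ab fs] x(1) by blast
  then show ?thesis using esd_limit_integral_nonneg[OF f nn] by simp
qed

text \<open>
  Convergence of the empirical distribution is only ever used for the monomials, where it is a
  statement about traces.
\<close>

lemma trace_moment_tendsto_in_prob:
  assumes \<delta>: "\<delta> > 0"
  shows "(\<lambda>n. measure (M n) {\<omega> \<in> space (M n). \<bar>mtrace (X n \<omega> ^\<^sub>m k) / real n - moment a b \<sigma> k\<bar> > \<delta>}) \<longlonglongrightarrow> 0"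
proof (rule Lim_transform_eventually)
  show "(\<lambda>n. measure (M n) {\<omega> \<in> space (M n).
      \<bar>measure_pmf.expectation (esd (X n \<omega>)) (\<lambda>x. x ^ k) - integral {a..b} (\<lambda>x. x ^ k * \<sigma> x)\<bar> > \<delta>}) \<longlonglongrightarrow> 0"
    by (rule conv[unfolded esd_tendsto_in_prob_def, rule_format]) (intro continuous_intros, rule \<delta>)
  show "\<forall>\<^sub>F n in sequentially. measure (M n) {\<omega> \<in> space (M n).
      \<bar>measure_pmf.expectation (esd (X n \<omega>)) (\<lambda>x. x ^ k) - integral {a..b} (\<lambda>x. x ^ k * \<sigma> x)\<bar> > \<delta>}
    = measure (M n) {\<omega> \<in> space (M n). \<bar>mtrace (X n \<omega> ^\<^sub>m k) / real n - moment a b \<sigma> k\<bar> > \<delta>}"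
    using eventually_ge_at_top[of 1]
  proof eventually_elim
    case (elim n)
    have "measure_pmf.expectation (esd (X n \<omega>)) (\<lambda>x. x ^ k) = mtrace (X n \<omega> ^\<^sub>m k) / real n"
      if "\<omega> \<in> space (M n)" for \<omega>
      unfolding expectation_esd[OF symm[OF elim that] elim] eig_sum_pow[OF symm[OF elim that]] ..
    then show ?case
      unfolding moment_def by (intro arg_cong2[where f = measure] refl Collect_cong) auto
  qed
qed

end

section \<open>Convergence of the relative error\<close>

lemma quotient_stable:
  fixes a b \<xi> \<epsilon> :: real
  assumes "a < b" "\<epsilon> > 0"
  obtains \<eta> where "\<eta> > 0"
    "\<And>x y z. \<lbrakk>\<bar>x - b\<bar> \<le> \<eta>; \<bar>y - a\<bar> \<le> \<eta>; \<bar>z - \<xi>\<bar> \<le> \<eta>\<rbrakk>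
      \<Longrightarrow> \<bar>(x - z) / (x - y) - (b - \<xi>) / (b - a)\<bar> \<le> \<epsilon>"
proof -
  have "isCont (\<lambda>p :: real \<times> real \<times> real. (fst p - snd (snd p)) / (fst p - fst (snd p))) (b, a, \<xi>)"
    using assms by (intro continuous_intros) auto
  then obtain d where d: "d > 0" "\<And>p. dist p (b, a, \<xi>) < d \<Longrightarrow>
      dist ((fst p - snd (snd p)) / (fst p - fst (snd p))) ((b - \<xi>) / (b - a)) < \<epsilon>"
    using assms(2) unfolding continuous_at_eps_delta by auto
  show thesis
  proof (rule that)
    show "d / 4 > 0" using d by simp
    fix x y z assume *: "\<bar>x - b\<bar> \<le> d / 4" "\<bar>y - a\<bar> \<le> d / 4" "\<bar>z - \<xi>\<bar> \<le> d / 4"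
    have "dist (x, y, z) (b, a, \<xi>) \<le> dist x b + dist (y, z) (a, \<xi>)"
      unfolding dist_Pair_Pair[of x _ b] by (intro sqrt_sum_squares_le_sum) auto
    also have "dist (y, z) (a, \<xi>) \<le> dist y a + dist z \<xi>"
      unfolding dist_Pair_Pair by (intro sqrt_sum_squares_le_sum) auto
    finally have "dist (x, y, z) (b, a, \<xi>) < d" using * d(1) by (simp add: dist_real_def)
    from d(2)[OF this] show "\<bar>(x - z) / (x - y) - (b - \<xi>) / (b - a)\<bar> \<le> \<epsilon>"
      by (simp add: dist_real_def)
  qed
qed

theorem theorem4p3:
  fixes a b :: real and \<sigma> :: "real \<Rightarrow> real"
    and M :: "nat \<Rightarrow> 'a measure"
    and X :: "nat \<Rightarrow> 'a \<Rightarrow> real mat" and v :: "nat \<Rightarrow> 'a \<Rightarrow> real vec"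
    and m :: nat and \<epsilon> :: real
  assumes "a < b"
    and "\<And>n. n \<ge> 1 \<Longrightarrow> prob_space (M n)"
    and "\<And>n \<omega>. n \<ge> 1 \<Longrightarrow> \<omega> \<in> space (M n) \<Longrightarrow> X n \<omega> \<in> symmetric_mats n"
    and "\<And>n \<omega> i. n \<ge> 1 \<Longrightarrow> \<omega> \<in> space (M n) \<Longrightarrow> i \<in> {1..n} \<Longrightarrow> eig (X n \<omega>) i \<in> {a..b}"
    and "continuous_on {a..b} \<sigma>"
    and "a \<in> support_within a b \<sigma>" and "b \<in> support_within a b \<sigma>"
    and "esd_tendsto_in_prob M X a b \<sigma>"
    and "\<And>n. n \<ge> 1 \<Longrightarrow> distr (M n) (vec_borel n) (v n) = uniform_sphere n"
    and "\<And>n. n \<ge> 1 \<Longrightarrow> indep_rvs (M n) (mat_borel n) (X n) (vec_borel n) (v n)"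
    and "m \<ge> 1" and "\<epsilon> > 0"
  shows "(\<lambda>n. measure (M n) {\<omega> \<in> space (M n).
           \<bar>(eig (X n \<omega>) 1 - ritz_max m (X n \<omega>) (v n \<omega>)) / (eig (X n \<omega>) 1 - eig (X n \<omega>) n)
             - (b - largest_zero (orth_poly a b \<sigma> m)) / (b - a)\<bar> > \<epsilon>}) \<longlonglongrightarrow> 0"
proof -
  note ab = assms(1) and prob = assms(2) and symm = assms(3) and eig_range = assms(4)
    and cont = assms(5) and conv = assms(8) and unif = assms(9) and ind = assms(10)
  note ctxt = ab prob symm eig_range cont conv
  have mass: "integral {a..b} \<sigma> = 1" by (rule esd_limit_mass[OF ctxt])
  have nonneg: "\<sigma> x \<ge> 0" if "x \<in> {a..b}" for x by (rule esd_limit_nonneg[OF ctxt that])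
  then have nonneg': "\<forall>x\<in>{a..b}. \<sigma> x \<ge> 0" by blast
  define \<mu> where "\<mu> = moment a b \<sigma>"
  have \<mu>_pos: "hankel m \<mu> c > 0" if "\<exists>i<m. c i \<noteq> 0" for c
    unfolding \<mu>_def by (rule hankel_moment_pos[OF ab cont nonneg mass that])
  obtain \<kappa> \<theta> d where \<kappa>: "\<kappa> > 0" "\<And>c. \<kappa> * (\<Sum>i<m. (c i)\<^sup>2) \<le> hankel m \<mu> c"
    and \<theta>: "\<And>c. hankel m (\<lambda>k. \<mu> (Suc k)) c \<le> \<theta> * hankel m \<mu> c"
    and d: "\<exists>i<m. d i \<noteq> 0" "hankel m (\<lambda>k. \<mu> (Suc k)) d = \<theta> * hankel m \<mu> d"
    using hankel_extremal_ratio[OF \<open>m \<ge> 1\<close> \<mu>_pos, of "\<lambda>k. \<mu> (Suc k)"] by blast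
  have zero: "largest_zero (orth_poly a b \<sigma> m) = \<theta>"
    by (rule largest_zero_orth_poly[OF ab cont nonneg mass \<open>m \<ge> 1\<close> \<theta>[unfolded \<mu>_def] d[unfolded \<mu>_def]])
  obtain \<eta> where \<eta>: "\<eta> > 0" and quot: "\<And>x y z. \<lbrakk>\<bar>x - b\<bar> \<le> \<eta>; \<bar>y - a\<bar> \<le> \<eta>; \<bar>z - \<theta>\<bar> \<le> \<eta>\<rbrakk>
      \<Longrightarrow> \<bar>(x - z) / (x - y) - (b - \<theta>) / (b - a)\<bar> \<le> \<epsilon>"
    using quotient_stable[OF ab \<open>\<epsilon> > 0\<close>, of \<theta>] by blast
  obtain \<delta>0 where \<delta>0: "\<delta>0 > 0"
    and ratio: "\<forall>\<nu>. (\<forall>k\<le>2 * m. \<bar>\<nu> k - \<mu> k\<bar> \<le> \<delta>0) \<longrightarrow>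
      (\<forall>c. (\<exists>i<m. c i \<noteq> 0) \<longrightarrow> hankel m \<nu> c > 0) \<and>
      \<bar>(SUP c \<in> {c. \<exists>i<m. c i \<noteq> 0}. hankel m (\<lambda>k. \<nu> (Suc k)) c / hankel m \<nu> c) - \<theta>\<bar> \<le> \<eta>"
    using hankel_ratio_stable[OF \<kappa> \<theta> d \<eta>] by (elim exE conjE)
  have detect: "\<exists>K \<delta>. \<delta> > 0 \<and> (\<forall>n \<omega>. n \<ge> 1 \<longrightarrow> \<omega> \<in> space (M n) \<longrightarrow>
      (\<forall>k\<le>K. \<bar>mtrace (X n \<omega> ^\<^sub>m k) / real n - \<mu> k\<bar> \<le> \<delta>) \<longrightarrow> (\<exists>i\<in>{1..n}. f (eig (X n \<omega>) i) \<noteq> 0))"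
    if f: "continuous_on {a..b} f" "integral {a..b} (\<lambda>x. f x * \<sigma> x) > 0" for f
  proof -
    obtain K \<delta> where D: "\<delta> > 0" "\<forall>(n :: nat) e. n \<ge> 1 \<longrightarrow> (\<forall>i\<in>{1..n}. e i \<in> {a..b}) \<longrightarrow>
      (\<forall>k\<le>K. \<bar>(\<Sum>i=1..n. e i ^ k) / real n - integral {a..b} (\<lambda>x. x ^ k * \<sigma> x)\<bar> \<le> \<delta>) \<longrightarrow>
      (\<exists>i\<in>{1..n}. f (e i) \<noteq> 0)"
      using moments_detect_mass[OF cont nonneg' mass f] by (elim exE conjE)
    have "\<exists>i\<in>{1..n}. f (eig (X n \<omega>) i) \<noteq> 0"
      if "n \<ge> 1" "\<omega> \<in> space (M n)" "\<forall>k\<le>K. \<bar>mtrace (X n \<omega> ^\<^sub>m k) / real n - \<mu> k\<bar> \<le> \<delta>" for n \<omega>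
      using D(2)[rule_format, of n "eig (X n \<omega>)"] eig_range[OF that(1,2)] that
      by (simp only: eig_sum_pow[OF symm[OF that(1,2)]] \<mu>_def moment_def)
    then show ?thesis using D(1) by blast
  qed
  have c1: "continuous_on {a..b} (\<lambda>x. max 0 (x - (b - \<eta>)))"
    and c2: "continuous_on {a..b} (\<lambda>x. max 0 (a + \<eta> - x))"
    by (intro continuous_intros)+
  \<comment> \<open>Continuous bumps at the two end points, to be fed to the moment criterion.\<close>
  have "integral {a..b} (\<lambda>x. max 0 (x - (b - \<eta>)) * \<sigma> x) > 0"
    by (rule weight_positive_near_support[OF ctxt c1 _ assms(7) \<eta>]) auto
  from detect[OF c1 this] obtain K1 \<delta>1 where \<delta>1: "\<delta>1 > 0"
    and top: "\<forall>n \<omega>. n \<ge> 1 \<longrightarrow> \<omega> \<in> space (M n) \<longrightarrow>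
      (\<forall>k\<le>K1. \<bar>mtrace (X n \<omega> ^\<^sub>m k) / real n - \<mu> k\<bar> \<le> \<delta>1) \<longrightarrow>
      (\<exists>i\<in>{1..n}. max 0 (eig (X n \<omega>) i - (b - \<eta>)) \<noteq> 0)"
    by (elim exE conjE)
  have "integral {a..b} (\<lambda>x. max 0 (a + \<eta> - x) * \<sigma> x) > 0"
    by (rule weight_positive_near_support[OF ctxt c2 _ assms(6) \<eta>]) auto
  from detect[OF c2 this] obtain K2 \<delta>2 where \<delta>2: "\<delta>2 > 0"
    and bot: "\<forall>n \<omega>. n \<ge> 1 \<longrightarrow> \<omega> \<in> space (M n) \<longrightarrow>
      (\<forall>k\<le>K2. \<bar>mtrace (X n \<omega> ^\<^sub>m k) / real n - \<mu> k\<bar> \<le> \<delta>2) \<longrightarrow>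
      (\<exists>i\<in>{1..n}. max 0 (a + \<eta> - eig (X n \<omega>) i) \<noteq> 0)"
    by (elim exE conjE)
  define K where "K = max (2 * m) (max K1 K2)"
  \<comment> \<open>Half of \<open>\<delta>0\<close>: the Krylov moments are compared with \<open>\<mu>\<close> by way of the traces.\<close>
  define \<delta> where "\<delta> = min (\<delta>0 / 2) (min \<delta>1 \<delta>2)"
  have \<delta>: "\<delta> > 0" "\<delta> + \<delta> \<le> \<delta>0" "\<delta> \<le> \<delta>1" "\<delta> \<le> \<delta>2" using \<delta>0 \<delta>1 \<delta>2 by (auto simp: \<delta>_def)
  define C where "C = \<bar>a\<bar> + \<bar>b\<bar>"
  define B where "B n k = {\<omega> \<in> space (M n). \<bar>mtrace (X n \<omega> ^\<^sub>m k) / real n - \<mu> k\<bar> > \<delta>}" for n k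
  define h where "h n = (\<Sum>k\<le>K. measure (M n) (B n k) + 2 * C ^ (2 * k) / ((real n + 2) * \<delta>\<^sup>2))" for n
  let ?bad = "\<lambda>n. {\<omega> \<in> space (M n).
           \<bar>(eig (X n \<omega>) 1 - ritz_max m (X n \<omega>) (v n \<omega>)) / (eig (X n \<omega>) 1 - eig (X n \<omega>) n)
             - (b - largest_zero (orth_poly a b \<sigma> m)) / (b - a)\<bar> > \<epsilon>}"
  have bad_le: "measure (M n) (?bad n) \<le> h n" if n: "n \<ge> 2" for n
  proof -
    have n1: "n \<ge> 1" using n by simp
    interpret prob_space "M n" by (rule prob[OF n1])
    have mX: "X n \<in> measurable (M n) (mat_borel n)" and mV: "v n \<in> measurable (M n) (vec_borel n)"
      using ind[OF n1] by (auto simp: indep_rvs_def)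
    have "\<bar>eig (X n \<omega>) i\<bar> \<le> C" if "\<omega> \<in> space (M n)" "i \<in> {1..n}" for \<omega> i
      using eig_range[OF n1 that] by (auto simp: C_def)
    then have "\<exists>E. E \<in> sets (M n) \<and> measure (M n) E \<le> 2 * C ^ (2 * k) / ((real n + 2) * \<delta>\<^sup>2) \<and>
      (\<forall>\<omega>\<in>space (M n) - E. \<bar>v n \<omega> \<bullet> ((X n \<omega> ^\<^sub>m k) *\<^sub>v v n \<omega>) - mtrace (X n \<omega> ^\<^sub>m k) / real n\<bar> < \<delta>)" for k
      using krylov_moment_concentration[OF prob[OF n1] n ind[OF n1] unif[OF n1] symm[OF n1], of C \<delta> k] \<delta>(1)
      by metis
    then obtain E where E: "\<And>k. E k \<in> sets (M n)" 
      "\<And>k. measure (M n) (E k) \<le> 2 * C ^ (2 * k) / ((real n + 2) * \<delta>\<^sup>2)"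
      "\<And>k \<omega>. \<omega> \<in> space (M n) - E k \<Longrightarrow>
        \<bar>v n \<omega> \<bullet> ((X n \<omega> ^\<^sub>m k) *\<^sub>v v n \<omega>) - mtrace (X n \<omega> ^\<^sub>m k) / real n\<bar> < \<delta>"
      by metis
    have B: "B n k \<in> sets (M n)" for k
    proof -
      have [measurable]: "(\<lambda>\<omega>. mtrace (X n \<omega> ^\<^sub>m k)) \<in> borel_measurable (M n)"
        by (rule measurable_compose[OF mX measurable_mtrace_pow])
      show ?thesis unfolding B_def by measurable
    qed
    have "?bad n \<subseteq> (\<Union>k\<in>{..K}. B n k \<union> E k)"
    proof (rule subsetI, rule ccontr)
      fix \<omega> assume bad: "\<omega> \<in> ?bad n" and "\<omega> \<notin> (\<Union>k\<in>{..K}. B n k \<union> E k)"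
      then have \<omega>: "\<omega> \<in> space (M n)" and out: "\<omega> \<notin> B n k" "\<omega> \<notin> E k" if "k \<le> K" for k
        using that by auto
      have tr: "\<bar>mtrace (X n \<omega> ^\<^sub>m k) / real n - \<mu> k\<bar> \<le> \<delta>" if "k \<le> K" for k
        using out(1)[OF that] bad by (auto simp: B_def)
      define \<nu> where "\<nu> k = v n \<omega> \<bullet> ((X n \<omega> ^\<^sub>m k) *\<^sub>v v n \<omega>)" for k
      have \<nu>: "\<bar>\<nu> k - \<mu> k\<bar> \<le> \<delta>0" if "k \<le> 2 * m" for k
      proof -
        have "k \<le> K" using that by (simp add: K_def)
        then have "\<bar>\<nu> k - mtrace (X n \<omega> ^\<^sub>m k) / real n\<bar> < \<delta>"
          unfolding \<nu>_def using E(3)[of \<omega> k] out(2) bad by blast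
        then show ?thesis using tr[OF \<open>k \<le> K\<close>] \<delta>(2) by linarith
      qed
      have \<omega>: "\<omega> \<in> space (M n)" using bad by simp
      have A: "X n \<omega> \<in> symmetric_mats n" by (rule symm[OF n1 \<omega>])
      have vc: "v n \<omega> \<in> carrier_vec n" using measurable_space[OF mV \<omega>] by simp
      have "ritz_max m (X n \<omega>) (v n \<omega>)
        = (SUP c \<in> {c. \<exists>i<m. c i \<noteq> 0}. hankel m (\<lambda>k. \<nu> (Suc k)) c / hankel m \<nu> c)"
        unfolding \<nu>_def using ratio \<nu> by (intro ritz_max_hankel[OF A vc]) (auto simp: \<nu>_def)
      then have ritz: "\<bar>ritz_max m (X n \<omega>) (v n \<omega>) - \<theta>\<bar> \<le> \<eta>"
        using ratio \<nu> by simp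
      have "\<bar>mtrace (X n \<omega> ^\<^sub>m k) / real n - \<mu> k\<bar> \<le> \<delta>1" if "k \<le> K1" for k
      proof -
        have "k \<le> K" using that by (auto simp: K_def)
        from tr[OF this] \<delta>(3) show ?thesis by linarith
      qed
      then obtain i where i: "i \<in> {1..n}" "max 0 (eig (X n \<omega>) i - (b - \<eta>)) \<noteq> 0"
        using top n1 \<omega> by blast
      then have "b - \<eta> < eig (X n \<omega>) i" by (auto simp: max_def split: if_splits)
      also have "\<dots> \<le> eig (X n \<omega>) 1" using i by (intro eig_antimono[OF A]) auto
      finally have e1: "\<bar>eig (X n \<omega>) 1 - b\<bar> \<le> \<eta>" using eig_range[OF n1 \<omega>, of 1] n by auto
      have "\<bar>mtrace (X n \<omega> ^\<^sub>m k) / real n - \<mu> k\<bar> \<le> \<delta>2" if "k \<le> K2" for k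
      proof -
        have "k \<le> K" using that by (auto simp: K_def)
        from tr[OF this] \<delta>(4) show ?thesis by linarith
      qed
      then obtain j where j: "j \<in> {1..n}" "max 0 (a + \<eta> - eig (X n \<omega>) j) \<noteq> 0"
        using bot n1 \<omega> by blast
      have "eig (X n \<omega>) n \<le> eig (X n \<omega>) j" using j by (intro eig_antimono[OF A]) auto
      also have "\<dots> < a + \<eta>" using j by (auto simp: max_def split: if_splits)
      finally have en: "\<bar>eig (X n \<omega>) n - a\<bar> \<le> \<eta>" using eig_range[OF n1 \<omega>, of n] n by auto
      show False using quot[OF e1 en ritz] bad unfolding zero by simp
    qed
    then have "measure (M n) (?bad n) \<le> measure (M n) (\<Union>k\<in>{..K}. B n k \<union> E k)"
      using B E(1) by (intro finite_measure_mono) auto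
    also have "\<dots> \<le> (\<Sum>k\<le>K. measure (M n) (B n k \<union> E k))"
      using B E(1) by (intro measure_UNION_le) auto
    also have "\<dots> \<le> h n"
      unfolding h_def
    proof (intro sum_mono)
      fix k
      show "measure (M n) (B n k \<union> E k) \<le> measure (M n) (B n k) + 2 * C ^ (2 * k) / ((real n + 2) * \<delta>\<^sup>2)"
        using measure_Un_le[OF B E(1), of k k] E(2)[of k] by linarith
    qed
    finally show ?thesis .
  qed
  have "h \<longlonglongrightarrow> (\<Sum>k\<le>K. 0 + 0)"
    unfolding h_def
  proof (intro tendsto_sum tendsto_add)
    fix k
    show "(\<lambda>n. measure (M n) (B n k)) \<longlonglongrightarrow> 0"
      unfolding B_def \<mu>_def by (rule trace_moment_tendsto_in_prob[OF ctxt \<delta>(1)])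
    have "filterlim (\<lambda>n. real n + 2) at_top sequentially"
      by (rule filterlim_at_top_mono[OF filterlim_real_sequentially]) simp
    then have "filterlim (\<lambda>n. \<delta>\<^sup>2 * (real n + 2)) at_top sequentially"
      using \<delta>(1) by (intro filterlim_tendsto_pos_mult_at_top[OF tendsto_const]) auto
    then have "filterlim (\<lambda>n. (real n + 2) * \<delta>\<^sup>2) at_top sequentially"
      by (simp only: mult.commute)
    then show "(\<lambda>n. 2 * C ^ (2 * k) / ((real n + 2) * \<delta>\<^sup>2)) \<longlonglongrightarrow> 0"
      by (intro tendsto_divide_0[OF tendsto_const] filterlim_at_top_imp_at_infinity)
  qed
  then have lim: "h \<longlonglongrightarrow> 0" by simp
  have upper: "\<forall>\<^sub>F n in sequentially. measure (M n) (?bad n) \<le> h n"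
    using eventually_ge_at_top[of 2] by eventually_elim (rule bad_le)
  have lower: "\<forall>\<^sub>F n in sequentially. 0 \<le> measure (M n) (?bad n)" by simp
  show ?thesis by (rule tendsto_sandwich[OF lower upper tendsto_const lim])
qed

end
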